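(* There is a unique hermitian structure $(\cdot,\cdot)$ on ${}_D\mathbf W$ such that $(\mathbf 1,\mathbf 1)=1$ and such that for all $\chi,\psi\in{}_D\mathbf W$: (i) for $z\in D$, as an equality of meromorphic sections of $K$ on $D$, $(\chi,e(z)\psi)=-C^*(i(C(z))\chi,\psi)$, or equivalently $u(z)^2(\chi,\hat e(z)\psi)=(\hat i(C(z))\chi,\psi)$; (ii) for $z'\in D'$, as an equality of meromorphic sections of $K$ on $D'$, $(\chi,i(z')\psi)=-C^*(e(C(z'))\chi,\psi)$, or equivalently $u(z')^2(\chi,\hat i(z')\psi)=(\hat e(C(z'))\chi,\psi)$.
   Context: $\mathbb P$ is a complex projective line with canonical bundle $K$, and $C:\mathbb P\to\mathbb P$ is an antiholomorphic involution given in a suitable coordinate $u$ (a meromorphic function with one simple pole) by $u(C(z))=1/\overline{u(z)}$. $P$ is the pole of $u$; $D'$ is the component of the complement of the fixed-point set of $C$ that contains $P$, and $D=C(D')$ is the other component, so $D=\{|u|<1\}$. ${}_D\mathbf K$ is the space of meromorphic 1-forms on $\mathbb P$ with all residues zero and all poles in $D$; ${}_D\mathbf W=S^*({}_D\mathbf K)$ is its symmetric algebra, with vacuum $\mathbf 1=1\in\mathbb C$. A hermitian structure is antilinear in the first argument and linear in the second. For $z\in D$, $e(z):{}_D\mathbf W\to{}_D\mathbf W\otimes K_z$ is multiplication by $e_z=-\frac{du}{(u-u(z))^2}\otimes du_z$, where $K_z$ is the fibre of $K$ at $z$. For $z\notin D$, $i(z):{}_D\mathbf W\to{}_D\mathbf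 W\otimes K_z$ is the derivation with $i(z)\mathbf 1=0$ and $i(z)\alpha=-\alpha(z)$ for $\alpha\in{}_D\mathbf K$. One writes $e(z)=\hat e(z)\,du_z$ and $i(z)=\hat i(z)\,du_z$. $C^*$ is pull-back by $C$, taking $(0,1)$-covectors at $C(z)$ to $(1,0)$-covectors at $z$.
   Formalization: Uniqueness fails as stated, since the e_z do not span the 1-forms (du/u^3 is missed); the hermitian structure is also required to pair term by term with the Taylor expansion of e(z)ψ at each point of D. The "or equivalently" claims are proved for such structures. *)

theory Defs
  imports "HOL-Complex_Analysis.Complex_Analysis" "HOL-Library.Poly_Mapping" "HOL-Library.Multiset"
begin

section \<open>Symmetric algebras of complex vector spaces\<close>

class complex_vs = ab_group_add +
  fixes cscale :: "complex \<Rightarrow> 'a \<Rightarrow> 'a"  (infixr \<open>*c\<close> 75)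
  assumes cscale_add_right: "c *c (x + y) = c *c x + c *c y"
    and cscale_add_left: "(c + d) *c x = c *c x + d *c x"
    and cscale_cscale: "c *c d *c x = (c * d) *c x"
    and cscale_one: "1 *c x = x"

text \<open>
  The type \<open>'v multiset \<Rightarrow>\<^sub>0 complex\<close> is the free commutative complex algebra on the
  \<^emph>\<open>set\<close> \<open>'v\<close> (its monomials are the finite multisets).  The symmetric algebra of the
  vector space \<open>'v\<close> is its quotient by the ideal forcing the inclusion of the generators
  to be linear.
\<close>

type_synonym 'v free_alg = "'v multiset \<Rightarrow>\<^sub>0 complex"

definition free_gen :: "'v \<Rightarrow> 'v free_alg" where
  "free_gen v = Poly_Mapping.single {#v#} 1"

definition free_const :: "complex \<Rightarrow> 'v free_alg" where
  "free_const c = Poly_Mapping.single {#} c"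

definition sym_rels :: "'v::complex_vs free_alg set" where
  "sym_rels = {free_gen (v + w) - free_gen v - free_gen w | v w. True}
            \<union> {free_gen (c *c v) - free_const c * free_gen v | c v. True}"

interpretation free_mod: module "(*) :: 'v free_alg \<Rightarrow> 'v free_alg \<Rightarrow> 'v free_alg"
  by unfold_locales (simp_all add: algebra_simps)

text \<open>As the algebra is a module over itself, the span of a set is the ideal it generates.\<close>

definition sym_ideal :: "'v::complex_vs free_alg set" where
  "sym_ideal = free_mod.span sym_rels"

lemma sym_ideal_add: "p \<in> sym_ideal \<Longrightarrow> q \<in> sym_ideal \<Longrightarrow> p + q \<in> sym_ideal"
  and sym_ideal_diff: "p \<in> sym_ideal \<Longrightarrow> q \<in> sym_ideal \<Longrightarrow> p - q \<in> sym_ideal"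
  and sym_ideal_uminus: "p \<in> sym_ideal \<Longrightarrow> - p \<in> sym_ideal"
  and sym_ideal_mult: "p \<in> sym_ideal \<Longrightarrow> q * p \<in> sym_ideal"
  and sym_ideal_0: "0 \<in> sym_ideal"
  by (auto simp: sym_ideal_def free_mod.span_add free_mod.span_diff free_mod.span_neg
      free_mod.span_scale free_mod.span_zero)

lemma sym_ideal_eqI: "p = q \<Longrightarrow> p - q \<in> sym_ideal"
  by (simp add: sym_ideal_0)

lemma sym_ideal_induct [consumes 1, case_names rel zero add mult]:
  assumes "p \<in> sym_ideal"
    and "\<And>r. r \<in> sym_rels \<Longrightarrow> P r" "P 0"
    and "\<And>p q. P p \<Longrightarrow> P q \<Longrightarrow> P (p + q)"
    and "\<And>p q. p \<in> sym_ideal \<Longrightarrow> P p \<Longrightarrow> P (q * p)"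
  shows "P p"
proof -
  have "p \<in> sym_ideal \<and> P p"
    using assms(1) unfolding sym_ideal_def
  proof (induction rule: free_mod.span_induct_alt)
    case base
    show ?case using assms(3) by (simp add: free_mod.span_zero)
  next
    case (step c x y)
    have "x \<in> free_mod.span sym_rels" using step(1) by (rule free_mod.span_base)
    then have x: "c * x \<in> free_mod.span sym_rels" "P (c * x)"
      using assms(5)[of x c] assms(2)[OF step(1)] free_mod.span_scale[of x sym_rels c]
      by (simp_all add: sym_ideal_def)
    with step(2) show ?case
      using assms(4)[of "c * x" y] free_mod.span_add[of "c * x" sym_rels y] by blast
  qed
  then show ?thesis ..
qed

quotient_type (overloaded) 'v sym = "'v::complex_vs free_alg" / "\<lambda>p q. p - q \<in> sym_ideal"
proof (rule equivpI)
  show "reflp (\<lambda>p q. p - q \<in> (sym_ideal :: 'v free_alg set))"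
    by (auto intro!: reflpI simp: sym_ideal_0)
  show "symp (\<lambda>p q. p - q \<in> (sym_ideal :: 'v free_alg set))"
  proof (rule sympI)
    fix p q :: "'v free_alg" assume "p - q \<in> sym_ideal"
    from sym_ideal_uminus[OF this] show "q - p \<in> sym_ideal" by simp
  qed
  show "transp (\<lambda>p q. p - q \<in> (sym_ideal :: 'v free_alg set))"
  proof (rule transpI)
    fix p q r :: "'v free_alg" assume "p - q \<in> sym_ideal" "q - r \<in> sym_ideal"
    from sym_ideal_add[OF this] show "p - r \<in> sym_ideal" by simp
  qed
qed

lemma free_alg_induct [case_names single add]:
  fixes p :: "'v free_alg"
  assumes single: "\<And>m c. P (Poly_Mapping.single m c)"
    and add: "\<And>p q. P p \<Longrightarrow> P q \<Longrightarrow> P (p + q)"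
  shows "P p"
proof (induction p rule: update_induct)
  case const
  show ?case using single[of "{#}" 0] by simp
next
  case (update f a b)
  have "Poly_Mapping.lookup f a = 0"
    using update(1) by (simp add: in_keys_iff)
  then have "Poly_Mapping.update a b f = f + Poly_Mapping.single a b"
    by (intro poly_mapping_eqI) (auto simp: lookup_update lookup_add lookup_single when_def)
  then show ?case using add update(3) single by simp
qed

lemma free_const_lookup_mult:
  "Poly_Mapping.lookup (p * q) {#} = Poly_Mapping.lookup p {#} * Poly_Mapping.lookup q {#}"
  for p q :: "'v free_alg"
proof (induction p rule: free_alg_induct)
  case (single m c)
  show ?case
  proof (induction q rule: free_alg_induct)
    case (single m' c')
    show ?case by (simp add: mult_single lookup_single when_def)
  next
    case (add p q)
    then show ?case by (simp only: distrib_left lookup_add)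
  qed
next
  case (add p' q')
  then show ?case by (simp only: distrib_right lookup_add)
qed

lemma one_notin_sym_ideal: "(1 :: 'v::complex_vs free_alg) \<notin> sym_ideal"
proof
  have "Poly_Mapping.lookup p {#} = 0" if "p \<in> sym_ideal" for p :: "'v free_alg"
    using that
  proof (induction rule: sym_ideal_induct)
    case (rel r)
    then consider v w where "r = free_gen (v + w) - free_gen v - free_gen w"
      | c v where "r = free_gen (c *c v) - free_const c * free_gen v"
      unfolding sym_rels_def by blast
    then show ?case
      by cases (simp_all add: free_gen_def free_const_def lookup_minus free_const_lookup_mult
          lookup_single when_def)
  qed (simp_all add: lookup_add free_const_lookup_mult)
  moreover assume "(1 :: 'v free_alg) \<in> sym_ideal"
  ultimately have "Poly_Mapping.lookup (1 :: 'v free_alg) {#} = 0" by blast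
  then show False by (simp add: lookup_one when_def zero_multiset_def[symmetric])
qed

instantiation sym :: (complex_vs) comm_ring_1
begin

lift_definition zero_sym :: "'a sym" is 0 .
lift_definition one_sym :: "'a sym" is 1 .

lift_definition plus_sym :: "'a sym \<Rightarrow> 'a sym \<Rightarrow> 'a sym" is "(+)"
  subgoal premises prems for p p' q q'
    using sym_ideal_add[OF prems] by (simp add: algebra_simps)
  done

lift_definition minus_sym :: "'a sym \<Rightarrow> 'a sym \<Rightarrow> 'a sym" is "(-)"
  subgoal premises prems for p p' q q'
    using sym_ideal_diff[OF prems] by (simp add: algebra_simps)
  done

lift_definition uminus_sym :: "'a sym \<Rightarrow> 'a sym" is uminus
  subgoal premises prems for p p'
    using sym_ideal_uminus[OF prems] by (simp add: algebra_simps)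
  done

lift_definition times_sym :: "'a sym \<Rightarrow> 'a sym \<Rightarrow> 'a sym" is "(*)"
  subgoal premises prems for p p' q q'
  proof -
    have "p * q - p' * q' = q * (p - p') + p' * (q - q')"
      by (simp add: right_diff_distrib mult.commute)
    then show ?thesis
      by (simp only: sym_ideal_add[OF sym_ideal_mult[OF prems(1)] sym_ideal_mult[OF prems(2)]])
  qed
  done

instance
proof
  fix a b c :: "'a sym"
  show "a * b * c = a * (b * c)" by transfer (rule sym_ideal_eqI, rule mult.assoc)
  show "a * b = b * a" by transfer (rule sym_ideal_eqI, rule mult.commute)
  show "1 * a = a" by transfer (rule sym_ideal_eqI, rule mult_1_left)
  show "a + b + c = a + (b + c)" by transfer (rule sym_ideal_eqI, rule add.assoc)
  show "a + b = b + a" by transfer (rule sym_ideal_eqI, rule add.commute)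
  show "0 + a = a" by transfer (rule sym_ideal_eqI, rule add_0)
  show "- a + a = 0" by transfer (rule sym_ideal_eqI, rule left_minus)
  show "a - b = a + - b" by transfer (rule sym_ideal_eqI, rule diff_conv_add_uminus)
  show "(a + b) * c = a * c + b * c" by transfer (rule sym_ideal_eqI, rule distrib_right)
  show "(0::'a sym) \<noteq> 1"
  proof transfer
    show "(0 :: 'a free_alg) - 1 \<notin> sym_ideal"
      using sym_ideal_uminus[of "0 - 1 :: 'a free_alg"] one_notin_sym_ideal by auto
  qed
qed

end

lift_definition sym_const :: "complex \<Rightarrow> 'v::complex_vs sym" is free_const .

lift_definition sym_gen :: "'v::complex_vs \<Rightarrow> 'v sym" is free_gen .

instantiation sym :: (complex_vs) complex_vs
begin

definition cscale_sym :: "complex \<Rightarrow> 'a sym \<Rightarrow> 'a sym" where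
  "cscale_sym c p = sym_const c * p"

lemma sym_const_add: "sym_const (c + d) = sym_const c + sym_const d"
  by transfer (simp add: free_const_def single_add sym_ideal_0)

lemma sym_const_mult: "sym_const (c * d) = sym_const c * sym_const d"
  by transfer (simp add: free_const_def mult_single sym_ideal_0)

lemma sym_const_1: "sym_const 1 = 1"
  by transfer (simp add: free_const_def sym_ideal_0)

instance
  by standard
    (simp_all add: cscale_sym_def sym_const_add sym_const_mult sym_const_1 algebra_simps)

end

lemma sym_gen_add: "sym_gen (v + w) = sym_gen v + sym_gen w"
proof transfer
  fix v w :: 'a
  have "free_gen (v + w) - free_gen v - free_gen w \<in> sym_ideal"
    unfolding sym_ideal_def by (rule free_mod.span_base) (auto simp: sym_rels_def)
  then show "free_gen (v + w) - (free_gen v + free_gen w) \<in> sym_ideal"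
    by (simp only: diff_diff_add)
qed

lemma sym_gen_cscale: "sym_gen (c *c v) = c *c sym_gen v"
  unfolding cscale_sym_def
proof transfer
  fix c and v :: 'a
  show "free_gen (c *c v) - free_const c * free_gen v \<in> sym_ideal"
    unfolding sym_ideal_def by (rule free_mod.span_base) (auto simp: sym_rels_def)
qed

definition derivation :: "('v::complex_vs sym \<Rightarrow> 'v sym) \<Rightarrow> bool" where
  "derivation d \<longleftrightarrow>
     (\<forall>x y. d (x + y) = d x + d y) \<and> (\<forall>c x. d (c *c x) = c *c d x) \<and>
     (\<forall>x y. d (x * y) = d x * y + x * d y)"

text \<open>The derivation of the symmetric algebra extending a linear functional; it exists and is
  unique by \<open>sym_deriv_ex1\<close> below.\<close>

definition sym_deriv :: "('v::complex_vs \<Rightarrow> complex) \<Rightarrow> 'v sym \<Rightarrow> 'v sym" where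
  "sym_deriv \<phi> = (THE d. derivation d \<and> d 1 = 0 \<and> (\<forall>v. d (sym_gen v) = sym_const (\<phi> v)))"

definition mono_der :: "('v \<Rightarrow> complex) \<Rightarrow> 'v multiset \<Rightarrow> 'v free_alg" where
  "mono_der \<phi> m = (\<Sum>v\<in>#m. Poly_Mapping.single (m - {#v#}) (\<phi> v))"

definition free_der :: "('v \<Rightarrow> complex) \<Rightarrow> 'v free_alg \<Rightarrow> 'v free_alg" where
  "free_der \<phi> p = (\<Sum>m\<in>Poly_Mapping.keys p. free_const (Poly_Mapping.lookup p m) * mono_der \<phi> m)"

lemma free_const_0: "free_const 0 = 0"
  and free_const_1: "free_const 1 = 1"
  and free_const_add: "free_const (c + d) = free_const c + free_const d"
  and free_const_mult: "free_const (c * d) = free_const c * free_const d"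
  by (simp_all add: free_const_def single_add mult_single flip: single_one zero_multiset_def)

lemma single_eq_free_const: "Poly_Mapping.single m c = free_const c * Poly_Mapping.single m 1"
  by (simp add: free_const_def mult_single)

lemma free_der_superset:
  assumes "finite K" "Poly_Mapping.keys p \<subseteq> K"
  shows "free_der \<phi> p = (\<Sum>m\<in>K. free_const (Poly_Mapping.lookup p m) * mono_der \<phi> m)"
  unfolding free_der_def using assms
  by (intro sum.mono_neutral_left) (auto simp: in_keys_iff free_const_0)

lemma free_der_add: "free_der \<phi> (p + q) = free_der \<phi> p + free_der \<phi> q"
proof -
  let ?K = "Poly_Mapping.keys p \<union> Poly_Mapping.keys q"
  have "free_der \<phi> r = (\<Sum>m\<in>?K. free_const (Poly_Mapping.lookup r m) * mono_der \<phi> m)"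
    if "Poly_Mapping.keys r \<subseteq> ?K" for r
    using that by (intro free_der_superset) auto
  from this[of p] this[of q] this[of "p + q"] show ?thesis
    using keys_add[of p q]
    by (simp add: lookup_add free_const_add distrib_right sum.distrib)
qed

lemma free_der_0: "free_der \<phi> 0 = 0"
  by (simp add: free_der_def)

lemma free_der_diff: "free_der \<phi> (p - q) = free_der \<phi> p - free_der \<phi> q"
  using free_der_add[of \<phi> "p - q" q] by (simp add: eq_diff_eq)

lemma free_der_single: "free_der \<phi> (Poly_Mapping.single m c) = free_const c * mono_der \<phi> m"
  by (subst free_der_superset[of "{m}"]) auto

lemma mono_der_add:
  "mono_der \<phi> (m + n) = mono_der \<phi> m * Poly_Mapping.single n 1
                        + Poly_Mapping.single m 1 * mono_der \<phi> n"
proof -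
  have "(\<Sum>v\<in>#m. Poly_Mapping.single (m + n - {#v#}) (\<phi> v))
      = (\<Sum>v\<in>#m. Poly_Mapping.single (m - {#v#}) (\<phi> v) * Poly_Mapping.single n 1)"
    by (intro arg_cong[where f = sum_mset] image_mset_cong) (simp add: mult_single)
  moreover have "(\<Sum>v\<in>#n. Poly_Mapping.single (m + n - {#v#}) (\<phi> v))
      = (\<Sum>v\<in>#n. Poly_Mapping.single m 1 * Poly_Mapping.single (n - {#v#}) (\<phi> v))"
    by (intro arg_cong[where f = sum_mset] image_mset_cong) (simp add: mult_single)
  ultimately show ?thesis
    by (simp add: mono_der_def sum_mset_distrib_left sum_mset_distrib_right)
qed

lemma free_der_mult: "free_der \<phi> (p * q) = free_der \<phi> p * q + p * free_der \<phi> q"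
proof (induction p rule: free_alg_induct)
  case (single m c)
  show ?case
  proof (induction q rule: free_alg_induct)
    case (single n d)
    have "free_der \<phi> (Poly_Mapping.single m c * Poly_Mapping.single n d)
        = free_const c * free_const d * mono_der \<phi> (m + n)"
      by (simp only: mult_single free_der_single free_const_mult)
    also have "\<dots> = free_const c * mono_der \<phi> m * (free_const d * Poly_Mapping.single n 1)
        + free_const c * Poly_Mapping.single m 1 * (free_const d * mono_der \<phi> n)"
      by (simp only: mono_der_add distrib_left ac_simps)
    finally show ?case
      by (simp only: free_der_single flip: single_eq_free_const)
  next
    case (add p q)
    then show ?case by (simp only: distrib_left distrib_right free_der_add ac_simps)
  qed
next
  case (add p' q')
  then show ?case by (simp only: distrib_left distrib_right free_der_add ac_simps)
qed

lemma free_der_sym_ideal: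
  fixes \<phi> :: "'v::complex_vs \<Rightarrow> complex"
  assumes "\<And>v w. \<phi> (v + w) = \<phi> v + \<phi> w" "\<And>c v. \<phi> (c *c v) = c * \<phi> v" "p \<in> sym_ideal"
  shows "free_der \<phi> p \<in> sym_ideal"
  using assms(3)
proof (induction rule: sym_ideal_induct)
  case (rel r)
  have gen: "free_der \<phi> (free_gen v) = free_const (\<phi> v)" for v
    by (simp add: free_gen_def free_der_single free_const_1 mono_der_def free_const_def)
  have const: "free_der \<phi> (free_const c) = 0" for c
    by (simp add: free_const_def free_der_single mono_der_def)
  from rel consider v w where "r = free_gen (v + w) - free_gen v - free_gen w"
    | c v where "r = free_gen (c *c v) - free_const c * free_gen v"
    unfolding sym_rels_def by blast
  then have "free_der \<phi> r = 0"
    by cases (simp_all add: free_der_diff free_der_mult gen const assms free_const_add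
        free_const_mult)
  then show ?case by (simp add: sym_ideal_0)
next
  case zero
  show ?case by (simp add: free_der_0 sym_ideal_0)
next
  case (add p q)
  then show ?case by (simp add: free_der_add sym_ideal_add)
next
  case (mult p q)
  then show ?case by (auto simp: free_der_mult intro!: sym_ideal_add sym_ideal_mult)
qed

lemma sym_induct [case_names const gen add mult]:
  fixes x :: "'v::complex_vs sym"
  assumes const: "\<And>c. P (sym_const c)" and gen: "\<And>v. P (sym_gen v)"
    and add: "\<And>x y. P x \<Longrightarrow> P y \<Longrightarrow> P (x + y)" and mult: "\<And>x y. P x \<Longrightarrow> P y \<Longrightarrow> P (x * y)"
  shows "P x"
proof -
  have "P (abs_sym p)" for p :: "'v free_alg"
  proof (induction p rule: free_alg_induct)
    case (single m c)
    have "P (abs_sym (Poly_Mapping.single m 1))"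
    proof (induction m)
      case empty
      show ?case using const[of 1] by (simp add: sym_const.abs_eq free_const_def)
    next
      case (add v m)
      have "abs_sym (Poly_Mapping.single (add_mset v m) 1)
          = sym_gen v * abs_sym (Poly_Mapping.single m 1)"
        by (simp add: sym_gen.abs_eq free_gen_def times_sym.abs_eq mult_single)
      then show ?case using mult[OF gen[of v] add] by simp
    qed
    moreover have "abs_sym (Poly_Mapping.single m c)
        = sym_const c * abs_sym (Poly_Mapping.single m 1)"
      by (simp add: sym_const.abs_eq times_sym.abs_eq free_const_def mult_single)
    ultimately show ?case using mult[OF const[of c]] by simp
  next
    case (add p q)
    then show ?case using assms(3) by (simp flip: plus_sym.abs_eq)
  qed
  then show ?thesis by (metis Quotient_sym Quotient_abs_rep)
qed

lemma sym_deriv_ex1: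
  fixes \<phi> :: "'v::complex_vs \<Rightarrow> complex"
  assumes lin: "\<And>v w. \<phi> (v + w) = \<phi> v + \<phi> w" "\<And>c v. \<phi> (c *c v) = c * \<phi> v"
  shows "\<exists>!d. derivation d \<and> d 1 = 0 \<and> (\<forall>v. d (sym_gen v) = sym_const (\<phi> v))"
proof (rule ex_ex1I)
  define d :: "'v sym \<Rightarrow> 'v sym" where "d x = abs_sym (free_der \<phi> (rep_sym x))" for x
  have d_abs: "d (abs_sym p) = abs_sym (free_der \<phi> p)" for p
  proof -
    have "rep_sym (abs_sym p) - p \<in> sym_ideal"
      by (rule rep_abs_rsp_left[OF Quotient3_sym]) (rule sym_ideal_eqI, rule refl)
    from free_der_sym_ideal[OF lin this] show ?thesis
      unfolding d_def by (simp add: free_der_diff sym.abs_eq_iff)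
  qed
  have abs_cases: "\<exists>p. x = abs_sym p" for x :: "'v sym"
    by (metis Quotient_sym Quotient_abs_rep)
  have add: "d (x + y) = d x + d y" for x y
    using abs_cases[of x] abs_cases[of y]
    by (auto simp: plus_sym.abs_eq d_abs free_der_add)
  have mult: "d (x * y) = d x * y + x * d y" for x y
    using abs_cases[of x] abs_cases[of y]
    by (auto simp: plus_sym.abs_eq times_sym.abs_eq d_abs free_der_mult)
  have const: "d (sym_const c) = 0" for c
    by (simp add: sym_const.abs_eq d_abs free_const_def free_der_single mono_der_def
        zero_sym.abs_eq)
  have gen: "d (sym_gen v) = sym_const (\<phi> v)" for v
    by (simp add: sym_gen.abs_eq d_abs free_gen_def free_der_single free_const_1 mono_der_def
        sym_const.abs_eq free_const_def)
  show "\<exists>d. derivation d \<and> d 1 = 0 \<and> (\<forall>v. d (sym_gen v) = sym_const (\<phi> v))"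
    using add mult const gen const[of 1]
    by (intro exI[of _ d]) (simp add: derivation_def cscale_sym_def sym_const_1)
next
  fix d d' :: "'v sym \<Rightarrow> 'v sym"
  assume d: "derivation d \<and> d 1 = 0 \<and> (\<forall>v. d (sym_gen v) = sym_const (\<phi> v))"
    and d': "derivation d' \<and> d' 1 = 0 \<and> (\<forall>v. d' (sym_gen v) = sym_const (\<phi> v))"
  have deriv_const: "e (sym_const c) = 0" if "derivation e" "e 1 = 0" for e :: "'v sym \<Rightarrow> 'v sym" and c
  proof -
    have "e (c *c 1) = c *c e 1" using that(1) by (simp add: derivation_def)
    then show ?thesis using that(2) by (simp add: cscale_sym_def)
  qed
  have "d x = d' x" for x
  proof (induction x rule: sym_induct)
    case (const c)
    show ?case using deriv_const[of d c] deriv_const[of d' c] d d' by simp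
  next
    case (gen v)
    show ?case using d d' by simp
  next
    case (add x y)
    then show ?case using d d' by (simp add: derivation_def)
  next
    case (mult x y)
    then show ?case using d d' by (simp add: derivation_def)
  qed
  then show "d = d'" ..
qed


section \<open>The projective line and its involution\<close>

text \<open>
  The coordinate \<open>u\<close>, having a single simple pole, identifies the projective line with
  \<open>\<complex> \<union> {\<infinity>}\<close>; \<open>Pt w\<close> is the point with \<open>u = w\<close>, and \<open>Infty\<close> is the pole of \<open>u\<close>.
  All objects attached to a point are written in a fixed chart there: \<open>u\<close> at finite points
  and \<open>v = 1/u\<close> at \<open>Infty\<close>.
\<close>

datatype P1 = Pt complex | Infty

primrec ucoord :: "P1 \<Rightarrow> complex" where
  "ucoord (Pt w) = w"
| "ucoord Infty = 0" \<comment> \<open>dummy value at the pole of \<open>u\<close>\<close>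

primrec Cinv :: "P1 \<Rightarrow> P1" where
  "Cinv (Pt w) = (if w = 0 then Infty else Pt (1 / cnj w))"
| "Cinv Infty = Pt 0"

definition D :: "P1 set" where "D = {Pt w | w. cmod w < 1}"

definition D' :: "P1 set" where "D' = Cinv ` D"

lemma D'_altdef: "D' = insert Infty {Pt w | w. cmod w > 1}"
proof (intro set_eqI iffI)
  fix p assume "p \<in> D'"
  then obtain w where "cmod w < 1" "p = Cinv (Pt w)" by (auto simp: D'_def D_def)
  then show "p \<in> insert Infty {Pt w | w. cmod w > 1}"
    by (cases "w = 0") (auto simp: norm_divide)
next
  fix p assume p: "p \<in> insert Infty {Pt w | w. cmod w > 1}"
  then have "Cinv p \<in> D" "Cinv (Cinv p) = p"
    by (auto simp: D_def norm_divide)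
  then show "p \<in> D'" unfolding D'_def by (metis imageI)
qed


section \<open>Meromorphic 1-forms\<close>

text \<open>
  A 1-form \<open>f du\<close> is given by its coefficient \<open>f\<close>.  In the chart \<open>v = 1/u\<close> it reads
  \<open>- f(1/v) v\<^sup>-\<^sup>2 dv\<close>.
\<close>

primrec in_chart :: "(complex \<Rightarrow> complex) \<Rightarrow> P1 \<Rightarrow> complex \<Rightarrow> complex" where
  "in_chart f (Pt w) = f"
| "in_chart f Infty = (\<lambda>v. - f (1 / v) / v\<^sup>2)"

primrec chart_pt :: "P1 \<Rightarrow> complex" where
  "chart_pt (Pt w) = w"
| "chart_pt Infty = 0"

definition is_DK :: "(complex \<Rightarrow> complex) \<Rightarrow> bool" where
  "is_DK f \<longleftrightarrow>
     (\<forall>p. in_chart f p meromorphic_on {chart_pt p}) \<and>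
     (\<forall>p. residue (in_chart f p) (chart_pt p) = 0) \<and>
     (\<forall>p. is_pole (in_chart f p) (chart_pt p) \<longrightarrow> p \<in> D)"

lemma eventually_in_chart_eq:
  assumes "finite {z. f z \<noteq> g z}"
  shows "eventually (\<lambda>z. in_chart f p z = in_chart g p z) (at (chart_pt p))"
proof -
  have A: "eventually (\<lambda>z. f z = g z) (at w)" for w
  proof -
    have "open (- ({z. f z \<noteq> g z} - {w}))"
      using assms by (intro open_Compl finite_imp_closed finite_Diff)
    then have "eventually (\<lambda>z. z \<in> - ({z. f z \<noteq> g z} - {w}) - {w}) (at w)"
      by (rule eventually_at_in_open) simp
    then show ?thesis by eventually_elim auto
  qed
  have "eventually (\<lambda>z. f z = g z) at_infinity"
  proof -
    obtain b where "\<forall>z\<in>{z. f z \<noteq> g z}. norm z \<le> b"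
      using finite_imp_bounded[OF assms] by (auto simp: bounded_iff)
    then show ?thesis
      unfolding eventually_at_infinity by (intro exI[of _ "b + 1"]) force
  qed
  then have "eventually (\<lambda>v. f (1 / v) = g (1 / v)) (at 0)"
    using filterlim_inverse_at_infinity[where 'a = complex]
    by (auto simp: filterlim_iff inverse_eq_divide)
  with A show ?thesis by (cases p) (auto elim: eventually_mono)
qed

text \<open>A meromorphic coefficient has no meaningful value at its poles, so coefficients agreeing
  off a finite set represent the same form.\<close>

quotient_type DK = "complex \<Rightarrow> complex" / partial:
  "\<lambda>f g. is_DK f \<and> is_DK g \<and> finite {z. f z \<noteq> g z}"
proof (rule part_equivpI)
  have "in_chart (\<lambda>_. 0) p = (\<lambda>_. 0)" for p by (cases p) auto
  then have "is_DK (\<lambda>_. 0)" by (auto simp: is_DK_def residue_const)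
  then show "\<exists>x. is_DK x \<and> is_DK x \<and> finite {z. x z \<noteq> x z}" by auto
  show "symp (\<lambda>f g. is_DK f \<and> is_DK g \<and> finite {z. f z \<noteq> g z})"
    by (auto intro!: sympI elim: rev_finite_subset)
  show "transp (\<lambda>f g. is_DK f \<and> is_DK g \<and> finite {z. f z \<noteq> g z})"
  proof (rule transpI, safe)
    fix f g h :: "complex \<Rightarrow> complex"
    assume "finite {z. f z \<noteq> g z}" "finite {z. g z \<noteq> h z}"
    then have "finite ({z. f z \<noteq> g z} \<union> {z. g z \<noteq> h z})" by simp
    then show "finite {z. f z \<noteq> h z}" by (rule rev_finite_subset) auto
  qed
qed

lemma in_chart_add: "in_chart (\<lambda>z. f z + g z) p = (\<lambda>z. in_chart f p z + in_chart g p z)"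
  by (cases p) (simp_all add: fun_eq_iff diff_divide_distrib)

lemma in_chart_cmult: "in_chart (\<lambda>z. c * f z) p = (\<lambda>z. c * in_chart f p z)"
  by (cases p) auto

lemma meromorphic_at_residue_add:
  assumes "f meromorphic_on {z}" "g meromorphic_on {z}"
  shows "residue (\<lambda>x. f x + g x) z = residue f z + residue g z"
proof -
  obtain r where r: "r > 0" "f analytic_on ball z r - {z}"
    using assms(1) unfolding meromorphic_at_iff isolated_singularity_at_def by auto
  obtain s where s: "s > 0" "g analytic_on ball z s - {z}"
    using assms(2) unfolding meromorphic_at_iff isolated_singularity_at_def by auto
  have "f holomorphic_on ball z (min r s) - {z}" "g holomorphic_on ball z (min r s) - {z}"
    using r(2) s(2) by (auto intro!: analytic_imp_holomorphic intro: analytic_on_subset)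
  then show ?thesis using r(1) s(1) by (intro residue_add[of "ball z (min r s)"]) auto
qed

lemma meromorphic_at_residue_cmult:
  assumes "f meromorphic_on {z}"
  shows "residue (\<lambda>x. c * f x) z = c * residue f z"
proof -
  obtain r where r: "r > 0" "f analytic_on ball z r - {z}"
    using assms unfolding meromorphic_at_iff isolated_singularity_at_def by auto
  then show ?thesis
    by (intro residue_lmul[of "ball z r"]) (auto intro: analytic_imp_holomorphic)
qed

lemma meromorphic_at_pole_add:
  assumes "f meromorphic_on {z}" "g meromorphic_on {z}" "is_pole (\<lambda>x. f x + g x) z"
  shows "is_pole f z \<or> is_pole g z"
proof (rule ccontr)
  assume "\<not> ?thesis"
  with assms(1,2) obtain a b where "f \<midarrow>z\<rightarrow> a" "g \<midarrow>z\<rightarrow> b"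
    unfolding meromorphic_at_iff not_essential_def by auto
  then have "(\<lambda>x. f x + g x) \<midarrow>z\<rightarrow> a + b" by (intro tendsto_add)
  with assms(3) show False
    unfolding is_pole_def using not_tendsto_and_filterlim_at_infinity[of "at z"] by auto
qed

lemma is_DK_0: "is_DK (\<lambda>_. 0)"
proof -
  have "in_chart (\<lambda>_. 0) p = (\<lambda>_. 0)" for p by (cases p) auto
  then show ?thesis by (auto simp: is_DK_def residue_const)
qed

lemma is_DK_add: "is_DK f \<Longrightarrow> is_DK g \<Longrightarrow> is_DK (\<lambda>z. f z + g z)"
  unfolding is_DK_def in_chart_add
  by (auto simp: meromorphic_at_residue_add intro!: meromorphic_on_add
      dest: meromorphic_at_pole_add[rotated 2])

lemma is_DK_cmult: "is_DK f \<Longrightarrow> is_DK (\<lambda>z. c * f z)"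
  by (cases "c = 0")
    (auto simp: is_DK_0 is_DK_def in_chart_cmult meromorphic_at_residue_cmult
      intro!: meromorphic_on_mult)

lemma is_DK_uminus: "is_DK f \<Longrightarrow> is_DK (\<lambda>z. - f z)"
  using is_DK_cmult[of f "- 1"] by simp

lemma is_DK_diff: "is_DK f \<Longrightarrow> is_DK g \<Longrightarrow> is_DK (\<lambda>z. f z - g z)"
  using is_DK_add[OF _ is_DK_uminus, of f g] by simp

lemma finite_neq_binop:
  assumes "finite {z. f z \<noteq> f' z}" "finite {z. g z \<noteq> g' z}"
  shows "finite {z. H (f z) (g z) \<noteq> H (f' z) (g' z)}"
  using finite_UnI[OF assms] by (rule rev_finite_subset) auto

instantiation DK :: complex_vs
begin

lift_definition zero_DK :: DK is "\<lambda>_. 0"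
  by (simp add: is_DK_0)

lift_definition plus_DK :: "DK \<Rightarrow> DK \<Rightarrow> DK" is "\<lambda>f g z. f z + g z"
  by (simp add: is_DK_add finite_neq_binop[where H = "(+)"])

lift_definition minus_DK :: "DK \<Rightarrow> DK \<Rightarrow> DK" is "\<lambda>f g z. f z - g z"
  by (simp add: is_DK_diff finite_neq_binop[where H = "(-)"])

lift_definition uminus_DK :: "DK \<Rightarrow> DK" is "\<lambda>f z. - f z"
  by (simp add: is_DK_uminus)

lift_definition cscale_DK :: "complex \<Rightarrow> DK \<Rightarrow> DK" is "\<lambda>c f z. c * f z"
  by (auto simp: is_DK_cmult elim: rev_finite_subset)

instance
proof
  fix \<alpha> \<beta> \<gamma> :: DK and c d :: complex
  show "\<alpha> + \<beta> + \<gamma> = \<alpha> + (\<beta> + \<gamma>)" by transfer (simp add: is_DK_add add.assoc)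
  show "\<alpha> + \<beta> = \<beta> + \<alpha>" by transfer (simp add: is_DK_add add.commute)
  show "0 + \<alpha> = \<alpha>" by transfer simp
  show "- \<alpha> + \<alpha> = 0" by transfer (simp add: is_DK_0)
  show "\<alpha> - \<beta> = \<alpha> + - \<beta>" by transfer (simp add: is_DK_diff)
  show "c *c (\<alpha> + \<beta>) = c *c \<alpha> + c *c \<beta>"
    by transfer (simp add: is_DK_add is_DK_cmult flip: distrib_left)
  show "(c + d) *c \<alpha> = c *c \<alpha> + d *c \<alpha>"
    by transfer (simp add: is_DK_cmult flip: distrib_right)
  show "c *c d *c \<alpha> = (c * d) *c \<alpha>"
    by transfer (simp add: is_DK_cmult flip: mult.assoc)
  show "1 *c \<alpha> = \<alpha>" by transfer simp
qed

end

text \<open>The value of a form at a point, as a multiple of the differential of the chart there.\<close>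

lift_definition DK_at :: "DK \<Rightarrow> P1 \<Rightarrow> complex" is
  "\<lambda>f p. remove_sings (in_chart f p) (chart_pt p)"
proof (rule ext)
  fix f g :: "complex \<Rightarrow> complex" and p
  assume "is_DK f \<and> is_DK g \<and> finite {z. f z \<noteq> g z}"
  then show "remove_sings (in_chart f p) (chart_pt p) = remove_sings (in_chart g p) (chart_pt p)"
    by (intro remove_sings_cong eventually_in_chart_eq) auto
qed

lemma DK_regular_tendsto:
  assumes "is_DK f" "p \<notin> D"
  shows "in_chart f p \<midarrow>chart_pt p\<rightarrow> remove_sings (in_chart f p) (chart_pt p)"
  using assms unfolding is_DK_def meromorphic_at_iff not_essential_def
  by (metis remove_sings_eqI)

lemma DK_at_add: "p \<notin> D \<Longrightarrow> DK_at (\<alpha> + \<beta>) p = DK_at \<alpha> p + DK_at \<beta> p"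
proof transfer
  fix f g :: "complex \<Rightarrow> complex" and p
  assume "p \<notin> D" "is_DK f \<and> is_DK f \<and> finite {z. f z \<noteq> f z}"
    "is_DK g \<and> is_DK g \<and> finite {z. g z \<noteq> g z}"
  then show "remove_sings (in_chart (\<lambda>z. f z + g z) p) (chart_pt p)
      = remove_sings (in_chart f p) (chart_pt p) + remove_sings (in_chart g p) (chart_pt p)"
    unfolding in_chart_add by (intro remove_sings_eqI tendsto_add DK_regular_tendsto) auto
qed

lemma DK_at_cscale: "p \<notin> D \<Longrightarrow> DK_at (c *c \<alpha>) p = c * DK_at \<alpha> p"
proof transfer
  fix c and f :: "complex \<Rightarrow> complex" and p
  assume "p \<notin> D" "is_DK f \<and> is_DK f \<and> finite {z. f z \<noteq> f z}"
  then show "remove_sings (in_chart (\<lambda>z. c * f z) p) (chart_pt p)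
      = c * remove_sings (in_chart f p) (chart_pt p)"
    unfolding in_chart_cmult by (intro remove_sings_eqI tendsto_mult_left DK_regular_tendsto) auto
qed

lemma is_DK_polar:
  assumes "cmod a < 1"
  shows "is_DK (\<lambda>u. c / (u - a) ^ (n + 2))" (is "is_DK ?f")
proof -
  have fin: "?f meromorphic_on {w} \<and> residue ?f w = 0 \<and> (is_pole ?f w \<longrightarrow> Pt w \<in> D)" for w
  proof (cases "w = a")
    case True
    have "residue (\<lambda>u. c / (u - a) ^ Suc (Suc n)) a = 0"
      by (subst residue_holomorphic_over_power[of UNIV]) (auto simp: higher_deriv_const)
    with True assms show ?thesis by (auto simp: D_def intro!: meromorphic_intros)
  next
    case False
    then have "?f analytic_on {w}" by (auto intro!: analytic_intros)
    moreover have "?f holomorphic_on - {a}" by (auto intro!: holomorphic_intros)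
    then have "residue ?f w = 0" using False by (intro residue_holo[of "- {a}"]) auto
    ultimately show ?thesis
      using analytic_at_imp_no_pole analytic_on_imp_meromorphic_on by blast
  qed
  define g where "g = (\<lambda>v. - c * v ^ n / (1 - a * v) ^ (n + 2))"
  have an: "g analytic_on {0}" unfolding g_def by (auto intro!: analytic_intros)
  have eq: "eventually (\<lambda>v. in_chart ?f Infty v = g v) (at 0)"
    using eventually_neq_at_within[of 0 0 UNIV]
  proof eventually_elim
    case (elim v)
    then have "1 / v - a = (1 - a * v) / v" by (simp add: field_simps)
    then have "in_chart ?f Infty v = - (c / (((1 - a * v) / v) ^ (n + 2))) / v\<^sup>2" by simp
    also have "\<dots> = g v"
      using elim by (simp add: g_def power_divide power_add power2_eq_square)
    finally show ?case .
  qed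
  obtain S where S: "open S" "0 \<in> S" "g holomorphic_on S"
    using an unfolding analytic_at by auto
  have "residue (in_chart ?f Infty) 0 = residue g 0" by (rule residue_cong[OF eq refl])
  also have "\<dots> = 0" using S by (intro residue_holo)
  finally have 1: "residue (in_chart ?f Infty) 0 = 0" .
  have 2: "\<not> is_pole (in_chart ?f Infty) 0"
    using is_pole_cong[OF eq refl] analytic_at_imp_no_pole[OF an] by simp
  have 3: "in_chart ?f Infty meromorphic_on {0}" by (auto intro!: meromorphic_intros)
  have "in_chart ?f p meromorphic_on {chart_pt p} \<and> residue (in_chart ?f p) (chart_pt p) = 0 \<and>
      (is_pole (in_chart ?f p) (chart_pt p) \<longrightarrow> p \<in> D)" for p
  proof (cases p)
    case (Pt w)
    then show ?thesis using fin[of w] by simp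
  next
    case Infty
    with 1 2 3 show ?thesis by (simp only: chart_pt.simps simp_thms)
  qed
  then show ?thesis unfolding is_DK_def by blast
qed


section \<open>The operators \<open>e\<close> and \<open>i\<close>\<close>

type_synonym DW = "DK sym"

lift_definition e_form :: "complex \<Rightarrow> DK" is
  "\<lambda>a u. if cmod a < 1 then - 1 / (u - a)\<^sup>2 else 0"
  subgoal for a
    using is_DK_polar[of a "- 1" 0, unfolded add_0] is_DK_0
    by (cases "cmod a < 1") simp_all
  done

text \<open>The \<open>n\<close>-th coefficient of the expansion
  \<open>- 1/(u - w)\<^sup>2 = (\<Sum>n. - (n + 1) (u - a)\<^sup>-\<^sup>n\<^sup>-\<^sup>2 (w - a)\<^sup>n)\<close> of \<open>e_form w\<close> about \<open>w = a\<close>.\<close>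

lift_definition e_taylor :: "nat \<Rightarrow> complex \<Rightarrow> DK" is
  "\<lambda>n a u. if cmod a < 1 then - of_nat (n + 1) / (u - a) ^ (n + 2) else 0"
  subgoal for n a
    using is_DK_polar[of a "- of_nat (n + 1)" n] is_DK_0
    by (cases "cmod a < 1") (simp_all del: power_Suc of_nat_add of_nat_Suc)
  done

text \<open>
  \<open>e_hat\<close> and \<open>i_op\<close> are the coefficients of \<open>e(z)\<close>, for \<open>z \<in> D\<close>, and of \<open>i(z)\<close>, for \<open>z \<notin> D\<close>,
  with respect to the differential of the chart at \<open>z\<close>.  On \<open>D\<close> this differential is \<open>du\<close>.
  The coefficient \<open>i_hat\<close> of \<open>i(z)\<close> with respect to \<open>du\<close> is the same at finite points, and
  vanishes at \<open>Infty\<close>, where \<open>du\<close> has a pole.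
\<close>

definition e_hat :: "P1 \<Rightarrow> DW \<Rightarrow> DW" where
  "e_hat z \<psi> = sym_gen (e_form (ucoord z)) * \<psi>"

definition i_op :: "P1 \<Rightarrow> DW \<Rightarrow> DW" where
  "i_op z = sym_deriv (\<lambda>\<alpha>. - DK_at \<alpha> z)"

definition i_hat :: "P1 \<Rightarrow> DW \<Rightarrow> DW" where
  "i_hat z \<psi> = (if z = Infty then 0 else i_op z \<psi>)"

lemma i_op_characterization:
  assumes "z \<notin> D"
  shows "derivation (i_op z)" "i_op z 1 = 0" "i_op z (sym_gen \<alpha>) = sym_const (- DK_at \<alpha> z)"
proof -
  have "derivation (i_op z) \<and> i_op z 1 = 0 \<and>
      (\<forall>\<alpha>. i_op z (sym_gen \<alpha>) = sym_const (- DK_at \<alpha> z))"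
    unfolding i_op_def sym_deriv_def
    by (rule theI'[OF sym_deriv_ex1]) (simp_all add: DK_at_add DK_at_cscale assms)
  then show "derivation (i_op z)" "i_op z 1 = 0"
    "i_op z (sym_gen \<alpha>) = sym_const (- DK_at \<alpha> z)" by auto
qed


section \<open>Sections of the canonical bundle and hermitian structures\<close>

text \<open>
  A section of \<open>K\<close> is given by its coefficients with respect to the differentials of the charts.
  Equality of meromorphic sections is required at every point, since both sides of the relations
  below are defined at every point.
\<close>

definition meromorphic_section_on :: "P1 set \<Rightarrow> (P1 \<Rightarrow> complex) \<Rightarrow> bool" where
  "meromorphic_section_on A s \<longleftrightarrow>
     (\<forall>p\<in>A. in_chart (\<lambda>w. s (Pt w)) p meromorphic_on {chart_pt p})"

definition eq_meromorphic_sections_on :: "P1 set \<Rightarrow> (P1 \<Rightarrow> complex) \<Rightarrow> (P1 \<Rightarrow> complex) \<Rightarrow> bool" where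
  "eq_meromorphic_sections_on A s t \<longleftrightarrow>
     meromorphic_section_on A s \<and> meromorphic_section_on A t \<and> (\<forall>z\<in>A. s z = t z)"

text \<open>
  \<open>C_pull z c\<close> is the coefficient at \<open>z\<close> of the pull-back by \<open>C\<close> of the \<open>(0,1)\<close>-covector at
  \<open>C(z)\<close> with coefficient \<open>c\<close> (with respect to the conjugate differential of the chart).
  Away from \<open>0\<close> and \<open>\<infinity>\<close> the conjugate of \<open>u \<circ> C\<close> is \<open>1/u\<close>, whose differential is
  \<open>- u\<^sup>-\<^sup>2 du\<close>.  At \<open>u = 0\<close> the conjugate of \<open>v \<circ> C\<close> is \<open>u\<close>, and at \<open>\<infinity>\<close> the conjugate
  of \<open>u \<circ> C\<close> is \<open>v\<close>.
\<close>

definition C_pull :: "P1 \<Rightarrow> complex \<Rightarrow> complex" where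
  "C_pull z c = (if z = Pt 0 \<or> z = Infty then c else - c / (ucoord z)\<^sup>2)"

definition hermitian_structure :: "('w::complex_vs \<Rightarrow> 'w \<Rightarrow> complex) \<Rightarrow> bool" where
  "hermitian_structure h \<longleftrightarrow>
     (\<forall>x y z. h x (y + z) = h x y + h x z) \<and> (\<forall>c x y. h x (c *c y) = c * h x y) \<and>
     (\<forall>x y z. h (x + y) z = h x z + h y z) \<and> (\<forall>c x y. h (c *c x) y = cnj c * h x y) \<and>
     (\<forall>x y. h y x = cnj (h x y))"

text \<open>
  The sense in which \<open>(\<xi>, e(z)\<psi>)\<close> is a section of \<open>K\<close> obtained by pairing \<open>\<xi>\<close> with the
  section \<open>e(z)\<psi>\<close>: its Taylor expansion at every point of \<open>D\<close> is that of \<open>e(z)\<psi>\<close>, paired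
  with \<open>\<xi>\<close> term by term.  This is not automatic, because the forms \<open>e_form a\<close> do not span
  \<open>DK\<close> algebraically.  Without it uniqueness fails: if \<open>l(\<alpha>)\<close> is the coefficient of
  \<open>u\<^sup>-\<^sup>3 du\<close> in the principal part of \<open>\<alpha>\<close> at \<open>u = 0\<close>, then \<open>l\<close> vanishes on every
  \<open>e_form a\<close>, and adding the conjugate of \<open>l(\<alpha>)\<close> times \<open>l(\<beta>)\<close> to \<open>(\<alpha>, \<beta>)\<close> on \<open>DK\<close> and
  extending to the symmetric algebra by permanents gives a second hermitian structure that
  satisfies both adjointness relations at every point.
\<close>

definition pairs_termwise :: "(DW \<Rightarrow> DW \<Rightarrow> complex) \<Rightarrow> bool" where
  "pairs_termwise h \<longleftrightarrow>
     (\<forall>\<xi> \<psi> a. cmod a < 1 \<longrightarrow>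
        (\<lambda>w. h \<xi> (e_hat (Pt (a + w)) \<psi>)) has_fps_expansion
          Abs_fps (\<lambda>n. h \<xi> (sym_gen (e_taylor n a) * \<psi>)))"

end

theory Submission
  imports Defs
begin

text \<open>
  A form \<open>\<alpha>\<close> is holomorphic on the closed disc \<open>|v| \<le> 1\<close> in the chart \<open>v = 1/u\<close>; let
  \<open>\<alpha> = (\<Sum>k. \<alpha>\<^sub>k v\<^sup>k) dv\<close> there.  In these terms \<open>e_form a\<close> has the coefficients
  \<open>(k + 1) a\<^sup>k\<close>, so that for \<open>(\<alpha>, \<beta>) = (\<Sum>k. cnj \<alpha>\<^sub>k * \<beta>\<^sub>k / (k + 1))\<close> pairing with
  \<open>e_form a\<close> is evaluation at the reflected point \<open>C(a)\<close>.  This hermitian form on \<open>DK\<close> extends to the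
  symmetric algebra by letting a product \<open>\<alpha>\<^sub>1\<cdots>\<alpha>\<^sub>n\<close> act in the first argument as the composition of
  the commuting derivations \<open>(\<alpha>\<^sub>i, _)\<close>, followed by projection to the constants.

  Conversely, adjointness determines the pairing with \<open>e_form a * \<psi>\<close> from pairings with \<open>\<psi>\<close>, hence,
  by expanding in \<open>a\<close>, the pairing with \<open>e_taylor n a * \<psi>\<close>.  By partial fractions the forms
  \<open>e_taylor n a\<close> span \<open>DK\<close>, and induction on the degree gives uniqueness.
\<close>

section \<open>Derivations of symmetric algebras\<close>

lemma sym_gen_induct [case_names one scale add gen]:
  fixes x :: "'v::complex_vs sym"
  assumes one: "P 1" and scale: "\<And>c x. P x \<Longrightarrow> P (c *c x)"
    and add: "\<And>x y. P x \<Longrightarrow> P y \<Longrightarrow> P (x + y)" and gen: "\<And>v x. P x \<Longrightarrow> P (sym_gen v * x)"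
  shows "P x"
proof -
  have "\<forall>y. P y \<longrightarrow> P (x * y)"
  proof (induction x rule: sym_induct)
    case (const c)
    show ?case using scale by (auto simp: cscale_sym_def)
  next
    case (gen v)
    show ?case using assms(4) by blast
  next
    case (add x y)
    then show ?case using assms(3) by (auto simp: distrib_right)
  next
    case (mult x y)
    then show ?case by (auto simp: mult.assoc)
  qed
  with one show ?thesis by (metis mult.right_neutral)
qed

definition linear_functional :: "('v::complex_vs \<Rightarrow> complex) \<Rightarrow> bool" where
  "linear_functional \<phi> \<longleftrightarrow> (\<forall>v w. \<phi> (v + w) = \<phi> v + \<phi> w) \<and> (\<forall>c v. \<phi> (c *c v) = c * \<phi> v)"

lemma cscale_mult_left: "(c *c x) * y = c *c (x * y)"
  and cscale_mult_right: "x * (c *c y) = c *c (x * y)"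
  for x y :: "'v::complex_vs sym"
  by (simp_all add: cscale_sym_def ac_simps)

lemma cscale_0_left: "0 *c x = 0" for x :: "'v::complex_vs"
  using cscale_add_left[of 0 0 x] by simp

context
  fixes \<phi> :: "'v::complex_vs \<Rightarrow> complex"
  assumes \<phi>: "linear_functional \<phi>"
begin

lemma sym_deriv_props:
  "derivation (sym_deriv \<phi>)" "sym_deriv \<phi> 1 = 0" "sym_deriv \<phi> (sym_gen v) = sym_const (\<phi> v)"
proof -
  have "derivation (sym_deriv \<phi>) \<and> sym_deriv \<phi> 1 = 0 \<and>
      (\<forall>v. sym_deriv \<phi> (sym_gen v) = sym_const (\<phi> v))"
    unfolding sym_deriv_def
    by (rule theI'[OF sym_deriv_ex1]) (use \<phi> in \<open>auto simp: linear_functional_def\<close>)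
  then show "derivation (sym_deriv \<phi>)" "sym_deriv \<phi> 1 = 0"
    "sym_deriv \<phi> (sym_gen v) = sym_const (\<phi> v)" by auto
qed

lemma sym_deriv_add: "sym_deriv \<phi> (x + y) = sym_deriv \<phi> x + sym_deriv \<phi> y"
  and sym_deriv_cscale: "sym_deriv \<phi> (c *c x) = c *c sym_deriv \<phi> x"
  and sym_deriv_gen_mult: "sym_deriv \<phi> (sym_gen v * x) = \<phi> v *c x + sym_gen v * sym_deriv \<phi> x"
  using sym_deriv_props by (auto simp: derivation_def cscale_sym_def)

end

lemma sym_deriv_lincomb:
  fixes \<phi> \<psi> :: "'v::complex_vs \<Rightarrow> complex"
  assumes "linear_functional \<phi>" "linear_functional \<psi>"
  shows "sym_deriv (\<lambda>v. c * \<phi> v + d * \<psi> v) x = c *c sym_deriv \<phi> x + d *c sym_deriv \<psi> x"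
proof -
  have *: "linear_functional (\<lambda>v. c * \<phi> v + d * \<psi> v)"
    using assms by (simp add: linear_functional_def algebra_simps)
  show ?thesis
  proof (induction x rule: sym_gen_induct)
    case one
    show ?case using * assms by (simp add: sym_deriv_props cscale_sym_def)
  next
    case (scale b x)
    then show ?case using * assms
      by (simp add: sym_deriv_cscale cscale_add_right cscale_cscale mult.commute)
  next
    case (add x y)
    then show ?case using * assms
      by (simp add: sym_deriv_add cscale_add_right ac_simps)
  next
    case (gen v x)
    then show ?case using * assms
      by (simp add: sym_deriv_gen_mult cscale_add_right cscale_add_left cscale_cscale
          cscale_mult_right distrib_left add.assoc add.left_commute)
  qed
qed

lemma sym_deriv_sum:
  fixes \<phi> \<psi> :: "'v::complex_vs \<Rightarrow> complex"
  assumes "linear_functional \<phi>" "linear_functional \<psi>"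
  shows "sym_deriv (\<lambda>v. \<phi> v + \<psi> v) x = sym_deriv \<phi> x + sym_deriv \<psi> x"
  using sym_deriv_lincomb[OF assms, of 1 1 x] by (simp add: cscale_one)

lemma sym_deriv_scaled:
  fixes \<phi> :: "'v::complex_vs \<Rightarrow> complex"
  assumes "linear_functional \<phi>"
  shows "sym_deriv (\<lambda>v. c * \<phi> v) x = c *c sym_deriv \<phi> x"
  using sym_deriv_lincomb[OF assms assms, of c 0 x] by (simp add: cscale_0_left)

lemma sym_deriv_commute:
  fixes \<phi> \<psi> :: "'v::complex_vs \<Rightarrow> complex"
  assumes "linear_functional \<phi>" "linear_functional \<psi>"
  shows "sym_deriv \<phi> (sym_deriv \<psi> x) = sym_deriv \<psi> (sym_deriv \<phi> x)"
proof (induction x rule: sym_gen_induct)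
  case one
  have "sym_deriv \<theta> 0 = 0" if "linear_functional \<theta>" for \<theta> :: "'v \<Rightarrow> complex"
    using sym_deriv_add[OF that, of 0 0] by simp
  then show ?case using assms by (simp add: sym_deriv_props)
next
  case (scale c x)
  then show ?case using assms by (simp add: sym_deriv_cscale)
next
  case (add x y)
  then show ?case using assms by (simp add: sym_deriv_add)
next
  case (gen v x)
  then show ?case using assms
    by (simp add: sym_deriv_gen_mult sym_deriv_add sym_deriv_cscale add.left_commute)
qed

section \<open>Extension of a hermitian form to the symmetric algebra\<close>

lift_definition sym_eps :: "'v::complex_vs sym \<Rightarrow> complex" is "\<lambda>p. Poly_Mapping.lookup p {#}"
proof -
  have "Poly_Mapping.lookup p {#} = 0" if "p \<in> sym_ideal" for p :: "'v free_alg"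
    using that
  proof (induction rule: sym_ideal_induct)
    case (rel r)
    then consider v w where "r = free_gen (v + w) - free_gen v - free_gen w"
      | c v where "r = free_gen (c *c v) - free_const c * free_gen v"
      unfolding sym_rels_def by blast
    then show ?case
      by cases (simp_all add: free_gen_def free_const_def lookup_minus free_const_lookup_mult
          lookup_single when_def)
  qed (simp_all add: lookup_add free_const_lookup_mult)
  then show "Poly_Mapping.lookup p {#} = Poly_Mapping.lookup q {#}" if "p - q \<in> sym_ideal"
    for p q :: "'v free_alg"
    using that by (metis lookup_minus eq_iff_diff_eq_0)
qed

lemma sym_eps_add: "sym_eps (x + y) = sym_eps x + sym_eps y"
  by transfer (simp add: lookup_add)

lemma sym_eps_mult: "sym_eps (x * y) = sym_eps x * sym_eps y"
  by transfer (simp add: free_const_lookup_mult)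

lemma sym_eps_gen: "sym_eps (sym_gen v) = 0"
  by transfer (simp add: free_gen_def lookup_single when_def)

lemma sym_eps_const: "sym_eps (sym_const c) = c"
  by transfer (simp add: free_const_def lookup_single)

lemma sym_eps_cscale: "sym_eps (c *c x) = c * sym_eps x"
  by (simp add: cscale_sym_def sym_eps_mult sym_eps_const)

lemma sym_eps_one: "sym_eps 1 = 1"
  using sym_eps_const[of 1] by (simp add: sym_const_1)

lemma
  assumes "hermitian_structure h"
  shows hermitian_add_right: "h x (y + z) = h x y + h x z"
    and hermitian_cscale_right: "h x (c *c y) = c * h x y"
    and hermitian_add_left: "h (x + y) z = h x z + h y z"
    and hermitian_cscale_left: "h (c *c x) y = cnj c * h x y"
    and hermitian_swap: "h y x = cnj (h x y)"
  using assms unfolding hermitian_structure_def by blast+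

lemma hermitian_linear_functional: "hermitian_structure h \<Longrightarrow> linear_functional (h x)"
  by (simp add: linear_functional_def hermitian_add_right hermitian_cscale_right)

lemma free_gen_mult_single: "free_gen v * Poly_Mapping.single m c =
    Poly_Mapping.single (add_mset v m) c"
  by (simp add: free_gen_def mult_single)

definition free_pair :: "('v::complex_vs \<Rightarrow> 'v \<Rightarrow> complex) \<Rightarrow> 'v free_alg \<Rightarrow> 'v sym \<Rightarrow> complex" where
  "free_pair B p \<psi> = (\<Sum>m\<in>Poly_Mapping.keys p. cnj (Poly_Mapping.lookup p m) *
      sym_eps (fold_mset (\<lambda>v. sym_deriv (B v)) \<psi> m))"

definition sym_pair :: "('v::complex_vs \<Rightarrow> 'v \<Rightarrow> complex) \<Rightarrow> 'v sym \<Rightarrow> 'v sym \<Rightarrow> complex" where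
  "sym_pair B \<xi> = free_pair B (rep_sym \<xi>)"

context
  fixes B :: "'v::complex_vs \<Rightarrow> 'v \<Rightarrow> complex"
  assumes B: "hermitian_structure B"
begin

private lemma linB: "linear_functional (B v)"
  by (rule hermitian_linear_functional[OF B])

interpretation comp_fun_commute "\<lambda>v. sym_deriv (B v)"
  by standard (simp add: fun_eq_iff sym_deriv_commute linB)

private lemma fold_add: "fold_mset (\<lambda>v. sym_deriv (B v)) (x + y) m =
    fold_mset (\<lambda>v. sym_deriv (B v)) x m + fold_mset (\<lambda>v. sym_deriv (B v)) y m"
  by (induction m) (simp_all add: sym_deriv_add linB)

private lemma fold_cscale: "fold_mset (\<lambda>v. sym_deriv (B v)) (c *c x) m =
    c *c fold_mset (\<lambda>v. sym_deriv (B v)) x m"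
  by (induction m) (simp_all add: sym_deriv_cscale linB)

private lemma free_pair_superset:
  assumes "finite K" "Poly_Mapping.keys p \<subseteq> K"
  shows "free_pair B p \<psi> = (\<Sum>m\<in>K. cnj (Poly_Mapping.lookup p m) *
      sym_eps (fold_mset (\<lambda>v. sym_deriv (B v)) \<psi> m))"
  unfolding free_pair_def using assms
  by (intro sum.mono_neutral_left) (auto simp: in_keys_iff)

private lemma free_pair_add: "free_pair B (p + q) \<psi> = free_pair B p \<psi> + free_pair B q \<psi>"
proof -
  let ?K = "Poly_Mapping.keys p \<union> Poly_Mapping.keys q"
  have "free_pair B r \<psi> = (\<Sum>m\<in>?K. cnj (Poly_Mapping.lookup r m) *
      sym_eps (fold_mset (\<lambda>v. sym_deriv (B v)) \<psi> m))"
    if "Poly_Mapping.keys r \<subseteq> ?K" for r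
    using that by (intro free_pair_superset) auto
  from this[of p] this[of q] this[of "p + q"] show ?thesis
    using keys_add[of p q] by (simp add: lookup_add distrib_right sum.distrib)
qed

private lemma free_pair_diff: "free_pair B (p - q) \<psi> = free_pair B p \<psi> - free_pair B q \<psi>"
  using free_pair_add[of "p - q" q] by (simp add: eq_diff_eq)

private lemma free_pair_single:
  "free_pair B (Poly_Mapping.single m c) \<psi> = cnj c * sym_eps (fold_mset (\<lambda>v. sym_deriv (B v)) \<psi> m)"
  by (subst free_pair_superset[of "{m}"]) auto

private lemma free_pair_gen_mult: "free_pair B (free_gen v * p) \<psi> = free_pair B p (sym_deriv (B v) \<psi>)"
proof (induction p rule: free_alg_induct)
  case (single m c)
  show ?case by (simp add: free_gen_mult_single free_pair_single fold_mset_fun_left_comm)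
next
  case (add p q)
  then show ?case by (simp add: distrib_left free_pair_add)
qed

private lemma free_pair_const_mult: "free_pair B (free_const c * p) \<psi> = cnj c * free_pair B p \<psi>"
proof (induction p rule: free_alg_induct)
  case (single m d)
  show ?case by (simp add: free_const_def mult_single free_pair_single)
next
  case (add p q)
  then show ?case by (simp add: distrib_left free_pair_add)
qed

private lemma free_pair_add_right: "free_pair B p (x + y) = free_pair B p x + free_pair B p y"
  by (simp add: free_pair_def fold_add sym_eps_add distrib_left sum.distrib)

private lemma free_pair_cscale_right: "free_pair B p (c *c x) = c * free_pair B p x"
  by (simp add: free_pair_def fold_cscale sym_eps_cscale sum_distrib_left mult.left_commute)

private lemma free_pair_ideal: "p \<in> sym_ideal \<Longrightarrow> free_pair B (q * p) \<psi> = 0"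
proof (induction arbitrary: q \<psi> rule: sym_ideal_induct)
  case (rel r)
  have comm: "q * free_gen v = free_gen v * q" "q * (free_const c * p) = free_const c * (q * p)"
    for v c p by (rule mult.commute mult.left_commute)+
  have eq: "sym_deriv (B (v + w)) \<psi> = sym_deriv (B v) \<psi> + sym_deriv (B w) \<psi>"
    "sym_deriv (B (c *c v)) \<psi> = cnj c *c sym_deriv (B v) \<psi>" for v w c
  proof -
    have "B (v + w) = (\<lambda>x. B v x + B w x)" "B (c *c v) = (\<lambda>x. cnj c * B v x)"
      by (simp_all add: fun_eq_iff hermitian_add_left[OF B] hermitian_cscale_left[OF B])
    then show "sym_deriv (B (v + w)) \<psi> = sym_deriv (B v) \<psi> + sym_deriv (B w) \<psi>"
      "sym_deriv (B (c *c v)) \<psi> = cnj c *c sym_deriv (B v) \<psi>"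
      by (simp_all add: sym_deriv_sum sym_deriv_scaled linB)
  qed
  from rel consider v w where "r = free_gen (v + w) - free_gen v - free_gen w"
    | c v where "r = free_gen (c *c v) - free_const c * free_gen v"
    unfolding sym_rels_def by blast
  then show ?case
    by cases (simp_all only: right_diff_distrib free_pair_diff comm free_pair_gen_mult eq
        free_pair_const_mult free_pair_add_right free_pair_cscale_right add_diff_cancel_left'
        diff_self)
next
  case zero
  show ?case by (simp add: free_pair_def)
next
  case (add p q)
  then show ?case by (simp add: distrib_left free_pair_add)
next
  case (mult p q)
  then show ?case by (simp only: mult.assoc[symmetric])
qed

private lemma sym_pair_abs: "sym_pair B (abs_sym p) = free_pair B p"
proof
  fix \<psi>
  have "rep_sym (abs_sym p) - p \<in> sym_ideal"
    by (rule rep_abs_rsp_left[OF Quotient3_sym]) (rule sym_ideal_eqI, rule refl)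
  from free_pair_ideal[OF this, of 1] show "sym_pair B (abs_sym p) \<psi> = free_pair B p \<psi>"
    by (simp add: sym_pair_def free_pair_diff)
qed

private lemma abs_cases:
  fixes x :: "'v sym"
  obtains p where "x = abs_sym p"
  by (metis Quotient_sym Quotient_abs_rep)

private lemma sym_pair_simps:
  "sym_pair B (x + y) \<psi> = sym_pair B x \<psi> + sym_pair B y \<psi>"
  "sym_pair B (c *c x) \<psi> = cnj c * sym_pair B x \<psi>"
  "sym_pair B x (\<psi> + \<theta>) = sym_pair B x \<psi> + sym_pair B x \<theta>"
  "sym_pair B x (c *c \<psi>) = c * sym_pair B x \<psi>"
  "sym_pair B (sym_gen v * x) \<psi> = sym_pair B x (sym_deriv (B v) \<psi>)"
  "sym_pair B 1 \<psi> = sym_eps \<psi>"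
proof -
  obtain p q where [simp]: "x = abs_sym p" "y = abs_sym q" by (metis abs_cases)
  show "sym_pair B (x + y) \<psi> = sym_pair B x \<psi> + sym_pair B y \<psi>"
    "sym_pair B (c *c x) \<psi> = cnj c * sym_pair B x \<psi>"
    "sym_pair B x (\<psi> + \<theta>) = sym_pair B x \<psi> + sym_pair B x \<theta>"
    "sym_pair B x (c *c \<psi>) = c * sym_pair B x \<psi>"
    "sym_pair B (sym_gen v * x) \<psi> = sym_pair B x (sym_deriv (B v) \<psi>)"
    by (simp_all add: plus_sym.abs_eq cscale_sym_def sym_const.abs_eq sym_gen.abs_eq
        times_sym.abs_eq sym_pair_abs free_pair_add free_pair_const_mult free_pair_gen_mult
        free_pair_add_right flip: free_pair_cscale_right)
  have "sym_pair B (abs_sym 1) \<psi> = sym_eps \<psi>"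
    unfolding sym_pair_abs single_one[symmetric]
    using free_pair_single[of "{#}" 1] by simp
  then show "sym_pair B 1 \<psi> = sym_eps \<psi>" by (simp add: one_sym.abs_eq)
qed

private lemma sym_pair_0_left: "sym_pair B 0 \<psi> = 0"
  using sym_pair_simps(1)[of 0 0] by simp

private lemma sym_pair_gen_right:
  "sym_pair B \<xi> (sym_gen v * \<psi>) = sym_pair B (sym_deriv (B v) \<xi>) \<psi>"
proof (induction \<xi> arbitrary: \<psi> rule: sym_gen_induct)
  case one
  show ?case by (simp add: sym_pair_simps sym_eps_mult sym_eps_gen sym_deriv_props linB
        sym_pair_0_left)
next
  case (gen w \<xi>)
  have "B w v = cnj (B v w)" by (rule hermitian_swap[OF B])
  with gen show ?case
    by (simp add: sym_pair_simps sym_deriv_gen_mult sym_deriv_props linB)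
qed (simp_all add: sym_pair_simps sym_deriv_add sym_deriv_cscale linB)

private lemma sym_pair_hermitian: "sym_pair B \<psi> \<xi> = cnj (sym_pair B \<xi> \<psi>)"
proof (induction \<xi> arbitrary: \<psi> rule: sym_gen_induct)
  case one
  show ?case
  proof (induction \<psi> rule: sym_gen_induct)
    case (gen v x)
    have "sym_pair B x 0 = 0" using sym_pair_simps(3)[of x 0 0] by simp
    then show ?case by (simp add: sym_pair_simps sym_eps_mult sym_eps_gen sym_deriv_props linB)
  qed (simp_all add: sym_pair_simps sym_eps_one sym_eps_add sym_eps_cscale)
next
  case (gen v \<xi>)
  show ?case using gen[of "sym_deriv (B v) \<psi>"] by (simp add: sym_pair_gen_right sym_pair_simps)
qed (simp_all add: sym_pair_simps)

lemma hermitian_structure_sym_pair: "hermitian_structure (sym_pair B)"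
  unfolding hermitian_structure_def
  by (intro conjI allI sym_pair_hermitian) (simp_all add: sym_pair_simps)

lemma sym_pair_1_1: "sym_pair B 1 1 = 1"
  by (simp add: sym_pair_simps sym_eps_one)

lemma sym_pair_gen:
  "sym_pair B (sym_gen v * \<xi>) \<psi> = sym_pair B \<xi> (sym_deriv (B v) \<psi>)"
  "sym_pair B \<xi> (sym_gen v * \<psi>) = sym_pair B (sym_deriv (B v) \<xi>) \<psi>"
  by (fact sym_pair_simps sym_pair_gen_right)+

end

section \<open>Partial fractions\<close>

lemma analytic_div_power_principal_part:
  fixes g :: "complex \<Rightarrow> complex"
  assumes "g analytic_on {p}"
  shows "\<exists>c h. h analytic_on {p} \<and>
    (\<forall>\<^sub>F z in at p. g z / (z - p) ^ n = (\<Sum>k<n. c k / (z - p) ^ Suc k) + h z)"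
  using assms
proof (induction n arbitrary: g)
  case 0
  then show ?case by (intro exI[of _ "\<lambda>_. 0"] exI[of _ g]) auto
next
  case (Suc n)
  define g1 where "g1 = (\<lambda>z. if z = p then deriv g p else (g z - g p) / (z - p))"
  have g1: "g1 analytic_on {p}"
  proof -
    obtain r where r: "r > 0" "g holomorphic_on ball p r"
      using Suc.prems by (auto simp: analytic_on_def)
    have "g1 holomorphic_on ball p r"
      unfolding g1_def using r(2) by (rule pole_lemma_open) simp
    then show ?thesis using r(1) by (auto simp: analytic_on_def)
  qed
  obtain c h where ch: "h analytic_on {p}"
    "\<forall>\<^sub>F z in at p. g1 z / (z - p) ^ n = (\<Sum>k<n. c k / (z - p) ^ Suc k) + h z"
    using Suc.IH[OF g1] by blast
  have "\<forall>\<^sub>F z in at p. g z / (z - p) ^ Suc n =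
      (\<Sum>k<Suc n. (c(n := g p)) k / (z - p) ^ Suc k) + h z"
    using ch(2) eventually_neq_at_within[of p p UNIV]
  proof eventually_elim
    case (elim z)
    then have "g z = (z - p) * g1 z + g p" by (simp add: g1_def)
    then have "g z / (z - p) ^ Suc n = g1 z / (z - p) ^ n + g p / (z - p) ^ Suc n"
      using elim(2) by (simp add: add_divide_distrib)
    then show ?case using elim(1) by simp
  qed
  with ch(1) show ?case by blast
qed

lemma meromorphic_at_principal_part:
  fixes f :: "complex \<Rightarrow> complex"
  assumes "f meromorphic_on {p}"
  shows "\<exists>n c h. h analytic_on {p} \<and>
    (\<forall>\<^sub>F z in at p. f z = (\<Sum>k<n. c k / (z - p) ^ Suc k) + h z)"
proof -
  obtain F where F: "(\<lambda>w. f (p + w)) has_laurent_expansion F"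
    using assms unfolding meromorphic_on_def by auto
  define G where "G = fls_base_factor_to_fps F"
  define d where "d = fls_subdegree F"
  have ev: "\<forall>\<^sub>F z in at 0. eval_fls F z = f (p + z)" and R: "fls_conv_radius F > 0"
    using F by (auto simp: has_laurent_expansion_def)
  have "eval_fps G analytic_on {0}"
    using R by (intro analytic_intros) (auto simp: G_def fps_conv_radius_fls_regpart zero_ereal_def)
  then have "(eval_fps G \<circ> (\<lambda>z. z - p)) analytic_on {p}"
    by (intro analytic_on_compose) (auto intro!: analytic_intros)
  then have an: "(\<lambda>z. eval_fps G (z - p) * (z - p) ^ nat d) analytic_on {p}"
    by (auto intro!: analytic_intros simp: o_def)
  have "\<forall>\<^sub>F z in at p. eval_fls F (z - p) = f (p + (z - p))"
    using ev by (subst at_to_0) (simp add: eventually_filtermap add.commute)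
  then have "\<forall>\<^sub>F z in at p. f z = (eval_fps G (z - p) * (z - p) ^ nat d) / (z - p) ^ nat (- d)"
    using eventually_neq_at_within[of p p UNIV]
  proof eventually_elim
    case (elim z)
    have "f z = eval_fps G (z - p) * (z - p) powi d"
      using elim by (simp add: eval_fls_def G_def d_def)
    also have "(z - p) powi d = (z - p) ^ nat d / (z - p) ^ nat (- d)"
      by (auto simp: power_int_def divide_inverse power_inverse)
    finally show ?case by simp
  qed
  moreover obtain c h where "h analytic_on {p}"
    "\<forall>\<^sub>F z in at p. eval_fps G (z - p) * (z - p) ^ nat d / (z - p) ^ nat (- d) =
       (\<Sum>k<nat (- d). c k / (z - p) ^ Suc k) + h z"
    using analytic_div_power_principal_part[OF an, of "nat (- d)"] by blast
  ultimately show ?thesis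
    by (intro exI[of _ "nat (- d)"] exI[of _ c] exI[of _ h]) (auto elim: eventually_elim2)
qed

lemma residue_zero_principal_part:
  fixes f :: "complex \<Rightarrow> complex"
  assumes "f meromorphic_on {p}" "residue f p = 0"
  shows "\<exists>n c h. h analytic_on {p} \<and>
    (\<forall>\<^sub>F z in at p. f z = (\<Sum>k<n. c k / (z - p) ^ (k + 2)) + h z)"
proof -
  obtain n c h where h: "h analytic_on {p}" and
    ev: "\<forall>\<^sub>F z in at p. f z = (\<Sum>k<n. c k / (z - p) ^ Suc k) + h z"
    using meromorphic_at_principal_part[OF assms(1)] by blast
  have res: "residue (\<lambda>z. c k / (z - p) ^ Suc k) p = (if k = 0 then c 0 else 0)" for k
    by (subst residue_holomorphic_over_power[of UNIV]) (auto simp: higher_deriv_const)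
  have mero: "(\<lambda>z. c k / (z - p) ^ Suc k) meromorphic_on {p}" for k
    by (auto intro!: meromorphic_intros)
  have sum: "residue (\<lambda>z. \<Sum>k<m. c k / (z - p) ^ Suc k) p = (\<Sum>k<m. if k = 0 then c 0 else 0) \<and>
      (\<lambda>z. \<Sum>k<m. c k / (z - p) ^ Suc k) meromorphic_on {p}" for m
  proof (induction m)
    case 0
    show ?case by (auto simp: residue_const intro!: meromorphic_intros)
  next
    case (Suc m)
    then show ?case
      using meromorphic_at_residue_add[OF conjunct2[OF Suc] mero[of m]] res[of m] mero[of m]
      by (auto simp del: power_Suc intro!: meromorphic_on_add)
  qed
  have "residue h p = 0"
    using h unfolding analytic_at by (auto intro: residue_holo)
  then have "residue f p = (\<Sum>k<n. if k = 0 then c 0 else 0)"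
    using residue_cong[OF ev refl] sum[of n] h
    by (subst (asm) meromorphic_at_residue_add) (auto intro: analytic_on_imp_meromorphic_on)
  with assms(2) have c0: "n = 0 \<or> c 0 = 0" by (auto split: if_splits)
  have "(\<Sum>k<n. c k / (z - p) ^ Suc k) = (\<Sum>k<n - 1. c (Suc k) / (z - p) ^ (k + 2))" for z
    using c0 by (cases n) (auto simp: sum.lessThan_Suc_shift simp del: sum.lessThan_Suc)
  with ev h show ?thesis
    by (intro exI[of _ "n - 1"] exI[of _ "\<lambda>k. c (Suc k)"] exI[of _ h]) auto
qed

lemma
  assumes "is_DK f"
  shows is_DK_imp_meromorphic: "in_chart f p meromorphic_on {chart_pt p}"
    and is_DK_imp_residue: "residue (in_chart f p) (chart_pt p) = 0"
    and is_DK_imp_pole: "is_pole (in_chart f p) (chart_pt p) \<Longrightarrow> p \<in> D"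
  using assms unfolding is_DK_def by blast+

lemma is_DK_finite_singularities:
  assumes "is_DK f"
  shows "finite {z. \<not> f analytic_on {z}}"
proof -
  have "f meromorphic_on {p}" for p
    using is_DK_imp_meromorphic[OF assms, of "Pt p"] by simp
  then have mero: "f meromorphic_on UNIV"
    by (simp add: meromorphic_on_def)
  have "isolated_singularity_at (in_chart f Infty) 0"
    using is_DK_imp_meromorphic[OF assms, of Infty] unfolding meromorphic_at_iff by simp
  then obtain r where r: "r > 0" "(\<lambda>v. - f (1 / v) / v\<^sup>2) analytic_on ball 0 r - {0}"
    by (auto simp: isolated_singularity_at_def)
  have "f analytic_on {w}" if w: "norm w > 1 / r" for w
  proof -
    have "w \<noteq> 0" using w r by (auto simp: field_simps)
    then have "1 / w \<in> ball 0 r - {0}" using w r by (auto simp: norm_divide field_simps)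
    then have 1: "(\<lambda>v. - f (1 / v) / v\<^sup>2) analytic_on {1 / w}"
      by (intro analytic_on_subset[OF r(2)]) auto
    define k where "k = (\<lambda>v. - f (1 / v) / v\<^sup>2) \<circ> (\<lambda>u. 1 / u)"
    have "k analytic_on {w}"
      unfolding k_def using \<open>w \<noteq> 0\<close> 1 by (intro analytic_on_compose) (auto intro!: analytic_intros)
    then have "(\<lambda>u. - k u / u\<^sup>2) analytic_on {w}"
      using \<open>w \<noteq> 0\<close> by (intro analytic_intros) auto
    moreover have ev: "\<forall>\<^sub>F u in nhds w. - k u / u\<^sup>2 = f u"
      using t1_space_nhds[OF \<open>w \<noteq> 0\<close>] by eventually_elim (simp add: k_def power_divide)
    ultimately show ?thesis using analytic_at_cong[OF ev refl] by blast
  qed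
  then have "{z. \<not> f analytic_on {z}} \<subseteq> cball 0 (1 / r)" by force
  moreover have "{z. \<not> f analytic_on {z}} sparse_in UNIV"
    using meromorphic_on_imp_analytic_cosparse[OF mero] by (simp add: eventually_cosparse)
  then have "finite (cball 0 (1 / r) \<inter> {z. \<not> f analytic_on {z}})"
    by (intro sparse_in_compact_finite) (auto elim: sparse_in_subset)
  ultimately show ?thesis by (simp add: Int_absorb1)
qed

lemma is_DK_partial_fractions:
  assumes f: "is_DK f"
  shows "\<exists>T N c. finite T \<and> T \<subseteq> ball 0 1 \<and>
    finite {u. f u \<noteq> (\<Sum>p\<in>T. \<Sum>k<N p. c p k / (u - p) ^ (k + 2))}"
proof -
  define T where "T = {z. \<not> f analytic_on {z}} \<inter> ball 0 1"
  have fin: "finite T" using is_DK_finite_singularities[OF f] by (simp add: T_def)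
  have mero: "f meromorphic_on {p}" and res: "residue f p = 0"
    and pole: "is_pole f p \<Longrightarrow> norm p < 1" for p
    using is_DK_imp_meromorphic[OF f, of "Pt p"] is_DK_imp_residue[OF f, of "Pt p"]
      is_DK_imp_pole[OF f, of "Pt p"] by (auto simp: D_def)
  have "\<forall>p. \<exists>n c h. h analytic_on {p} \<and>
    (\<forall>\<^sub>F z in at p. f z = (\<Sum>k<n. c k / (z - p) ^ (k + 2)) + h z)"
    by (intro allI residue_zero_principal_part mero res)
  then obtain N c h where h: "\<And>p. h p analytic_on {p}" and
    ev: "\<And>p. \<forall>\<^sub>F z in at p. f z = (\<Sum>k<N p. c p k / (z - p) ^ (k + 2)) + h p z"
    unfolding choice_iff by blast
  define P where "P = (\<lambda>p z. \<Sum>k<N p. c p k / (z - p) ^ (k + 2))"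
  define g where "g = (\<lambda>z. f z - (\<Sum>p\<in>T. P p z))"
  have Pan: "P p analytic_on {q}" if "p \<noteq> q" for p q
    unfolding P_def using that by (auto intro!: analytic_intros)
  have Pmero: "P p meromorphic_on {q}" for p q
    unfolding P_def by (auto intro!: meromorphic_intros)
  have gmero: "g meromorphic_on {q}" for q
    unfolding g_def by (intro meromorphic_intros mero Pmero)
  have "\<exists>l. g \<midarrow>q\<rightarrow> l" for q
  proof (cases "q \<in> T")
    case True
    define k where "k = (\<lambda>z. h q z - (\<Sum>p\<in>T - {q}. P p z))"
    have "k analytic_on {q}" unfolding k_def using h by (intro analytic_intros Pan) auto
    then have "k \<midarrow>q\<rightarrow> k q" by (simp add: analytic_at_imp_isCont isContD)
    moreover have "\<forall>\<^sub>F z in at q. k z = g z"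
      using ev[of q] by eventually_elim (simp add: k_def g_def P_def sum.remove[OF fin True])
    ultimately show ?thesis using Lim_transform_eventually by blast
  next
    case False
    have "\<exists>l. f \<midarrow>q\<rightarrow> l"
    proof (cases "f analytic_on {q}")
      case True
      then show ?thesis by (meson analytic_at_imp_isCont isContD)
    next
      case na: False
      with False have "\<not> is_pole f q" using pole by (auto simp: T_def)
      then show ?thesis using mero[of q] unfolding meromorphic_at_iff not_essential_def by blast
    qed
    then obtain l where "f \<midarrow>q\<rightarrow> l" ..
    moreover have "(\<lambda>z. \<Sum>p\<in>T. P p z) analytic_on {q}"
      using False by (intro analytic_intros Pan) auto
    then have "(\<lambda>z. \<Sum>p\<in>T. P p z) \<midarrow>q\<rightarrow> (\<Sum>p\<in>T. P p q)"
      by (intro isContD analytic_at_imp_isCont)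
    ultimately have "g \<midarrow>q\<rightarrow> l - (\<Sum>p\<in>T. P p q)"
      unfolding g_def by (rule tendsto_diff)
    then show ?thesis ..
  qed
  then have an: "remove_sings g analytic_on {q}" for q
    using gmero[of q] remove_sings_analytic_at unfolding meromorphic_at_iff by blast
  have eq: "remove_sings g z = g z" if "f analytic_on {z}" "z \<notin> T" for z
  proof (rule remove_sings_at_analytic)
    show "g analytic_on {z}" unfolding g_def using that by (intro analytic_intros Pan) auto
  qed
  have fin2: "finite ({z. \<not> f analytic_on {z}} \<union> T)"
    using fin is_DK_finite_singularities[OF f] by simp
  have evinf: "\<forall>\<^sub>F z in at_infinity. g z = remove_sings g z"
  proof -
    obtain b where b: "\<And>z. z \<in> {z. \<not> f analytic_on {z}} \<union> T \<Longrightarrow> norm z \<le> b"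
      using finite_imp_bounded[OF fin2] by (auto simp: bounded_iff)
    have "g z = remove_sings g z" if "norm z \<ge> b + 1" for z
      using b[of z] that eq[of z] by fastforce
    then show ?thesis unfolding eventually_at_infinity by blast
  qed
  have f0: "(f \<longlongrightarrow> 0) at_infinity"
  proof -
    have "\<not> is_pole (in_chart f Infty) 0" "in_chart f Infty meromorphic_on {0}"
      using is_DK_imp_meromorphic[OF f, of Infty] is_DK_imp_pole[OF f, of Infty]
      by (auto simp: D_def)
    then obtain l where "in_chart f Infty \<midarrow>0\<rightarrow> l"
      unfolding meromorphic_at_iff not_essential_def by blast
    then have "(\<lambda>v. - (- f (1 / v) / v\<^sup>2) * v\<^sup>2) \<midarrow>0\<rightarrow> - l * 0\<^sup>2"
      by (intro tendsto_intros) simp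
    moreover have "\<forall>\<^sub>F v in at 0. - (- f (1 / v) / v\<^sup>2) * v\<^sup>2 = (f \<circ> inverse) v"
      by (simp add: eventually_at_filter inverse_eq_divide)
    ultimately have "(f \<circ> inverse) \<midarrow>0\<rightarrow> - l * 0\<^sup>2"
      by (rule Lim_transform_eventually)
    then show ?thesis by (simp add: lim_at_infinity_0)
  qed
  have P0: "(P p \<longlongrightarrow> 0) at_infinity" for p
  proof -
    have "filterlim (\<lambda>z. z - p) at_infinity at_infinity"
      using tendsto_add_filterlim_at_infinity[OF tendsto_const[of "-p"] filterlim_ident] by simp
    then have "filterlim (\<lambda>z. (z - p) ^ (k + 2)) at_infinity at_infinity" for k
      by (rule Limits.filterlim_power_at_infinity) simp
    then have "((\<lambda>z. c p k / (z - p) ^ (k + 2)) \<longlongrightarrow> 0) at_infinity" for k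
      by (rule tendsto_divide_0[OF tendsto_const])
    then show ?thesis unfolding P_def by (intro tendsto_null_sum)
  qed
  have "(g \<longlongrightarrow> 0 - 0) at_infinity"
    unfolding g_def by (intro tendsto_diff tendsto_null_sum f0 P0)
  then have "(remove_sings g \<longlongrightarrow> 0) at_infinity"
    by (intro Lim_transform_eventually[OF _ evinf]) simp
  moreover have "remove_sings g analytic_on UNIV"
    using an by (subst analytic_on_analytic_at) simp
  then have "remove_sings g holomorphic_on UNIV"
    by (rule analytic_imp_holomorphic)
  ultimately have zero: "remove_sings g z = 0" for z by (intro Liouville_weak_0)
  have f_eq0: "f z = (\<Sum>p\<in>T. P p z)" if "f analytic_on {z}" "z \<notin> T" for z
    using eq[OF that] zero[of z] by (simp add: g_def)
  then have f_eq: "finite {u. f u \<noteq> (\<Sum>p\<in>T. P p u)}"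
  proof (intro finite_subset[OF _ fin2] subsetI)
    fix u assume "u \<in> {u. f u \<noteq> (\<Sum>p\<in>T. P p u)}"
    then have "f u \<noteq> (\<Sum>p\<in>T. P p u)" by (rule CollectD)
    with f_eq0[of u] show "u \<in> {z. \<not> f analytic_on {z}} \<union> T" by blast
  qed
  show ?thesis
  proof (intro exI[of _ T] exI[of _ N] exI[of _ c] conjI)
    show "finite T" by (fact fin)
    show "T \<subseteq> ball 0 1" by (simp add: T_def)
    show "finite {u. f u \<noteq> (\<Sum>p\<in>T. \<Sum>k<N p. c p k / (u - p) ^ (k + 2))}"
      using f_eq unfolding P_def .
  qed
qed

lemma e_taylor_abs: "cmod a < 1 \<Longrightarrow> e_taylor n a = abs_DK (\<lambda>u. - of_nat (n + 1) / (u - a) ^ (n + 2))"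
  unfolding e_taylor_def by (simp only: if_True map_fun_apply id_apply)

lemma DK_induct [case_names e_taylor scale add]:
  assumes e_taylor: "\<And>n a. cmod a < 1 \<Longrightarrow> P (e_taylor n a)"
    and scale: "\<And>c \<alpha>. P \<alpha> \<Longrightarrow> P (c *c \<alpha>)"
    and add: "\<And>\<alpha> \<beta>. P \<alpha> \<Longrightarrow> P \<beta> \<Longrightarrow> P (\<alpha> + \<beta>)"
  shows "P \<alpha>"
proof -
  define Q where "Q f \<longleftrightarrow> is_DK f \<and> P (abs_DK f)" for f
  have Qscale: "Q (\<lambda>u. c * f u)" if "Q f" for c f
    using that scale[of "abs_DK f" c] unfolding Q_def
    by (simp add: is_DK_cmult cscale_DK.abs_eq eq_onp_same_args)
  have Qadd: "Q (\<lambda>u. f u + g u)" if "Q f" "Q g" for f g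
    using that add[of "abs_DK f" "abs_DK g"] unfolding Q_def
    by (simp add: is_DK_add plus_DK.abs_eq eq_onp_same_args)
  have Q1: "Q (\<lambda>u. c / (u - a) ^ (n + 2))" if "cmod a < 1" for c n a
  proof -
    have "Q (\<lambda>u. - of_nat (n + 1) / (u - a) ^ (n + 2))"
      using e_taylor[OF that, of n] is_DK_polar[OF that, of "- of_nat (n + 1)" n]
      unfolding Q_def e_taylor_abs[OF that] by blast
    from Qscale[OF this, of "- c / of_nat (n + 1)"] show ?thesis
      by (simp del: of_nat_Suc of_nat_add)
  qed
  have Q0: "Q (\<lambda>_. 0)" using Qscale[OF Q1[of 0 0 0], of 0] by simp
  have Qsum: "Q (\<lambda>u. \<Sum>i\<in>I. F i u)" if "\<And>i. i \<in> I \<Longrightarrow> Q (F i)" "finite I"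
    for I :: "'i set" and F
    using that(2,1) by (induction rule: finite_induct) (auto simp: Q0 Qadd)
  obtain f where f: "is_DK f" "\<alpha> = abs_DK f"
    using Quotient_abs_rep[OF Quotient_DK] Quotient_rep_reflp[OF Quotient_DK] by metis
  obtain T N c where T: "finite T" "T \<subseteq> ball 0 1"
    "finite {u. f u \<noteq> (\<Sum>p\<in>T. \<Sum>k<N p. c p k / (u - p) ^ (k + 2))}"
    using is_DK_partial_fractions[OF f(1)] by blast
  have "Q (\<lambda>u. \<Sum>p\<in>T. \<Sum>k<N p. c p k / (u - p) ^ (k + 2))"
    using T(1,2) by (intro Qsum Q1) auto
  moreover from this have "\<alpha> = abs_DK (\<lambda>u. \<Sum>p\<in>T. \<Sum>k<N p. c p k / (u - p) ^ (k + 2))"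
    unfolding f(2) using f(1) T(3) by (intro Quotient_rel_abs[OF Quotient_DK]) (auto simp: Q_def)
  ultimately show ?thesis by (simp add: Q_def)
qed

section \<open>Expansion in the chart at infinity\<close>

lemma sums_shift_zero:
  fixes f :: "nat \<Rightarrow> 'a::real_normed_vector"
  assumes "(\<lambda>k. f (k + n)) sums s" "\<And>i. i < n \<Longrightarrow> f i = 0"
  shows "f sums s"
  using assms by (simp add: sums_iff_shift)

lemma fps_deriv_funpow_nth:
  fixes F :: "'a::field_char_0 fps"
  shows "fps_nth ((fps_deriv ^^ n) F) k = fact (k + n) / fact k * fps_nth F (k + n)"
proof (induction n arbitrary: k)
  case (Suc n)
  have "fact (Suc k) = (of_nat (k + 1) * fact k :: 'a)" by (simp only: fact_Suc flip: Suc_eq_plus1)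
  then show ?case
    by (simp add: Suc.IH field_simps del: fact_Suc of_nat_Suc of_nat_add)
qed simp

lemma fps_conv_radius_deriv_funpow:
  fixes F :: "complex fps"
  shows "fps_conv_radius ((fps_deriv ^^ n) F) \<ge> fps_conv_radius F"
  by (induction n) (auto intro: order.trans fps_conv_radius_deriv)

lemma higher_deriv_eval_fps:
  fixes F :: "complex fps"
  assumes "ereal (norm z) < fps_conv_radius F"
  shows "(deriv ^^ n) (eval_fps F) z = eval_fps ((fps_deriv ^^ n) F) z"
  using assms
proof (induction n arbitrary: z)
  case (Suc n)
  have "\<forall>\<^sub>F x in nhds z. x \<in> eball 0 (fps_conv_radius F)"
    using Suc.prems by (intro eventually_nhds_in_open) (auto simp: in_eball_iff)
  then have "\<forall>\<^sub>F x in nhds z. (deriv ^^ n) (eval_fps F) x = eval_fps ((fps_deriv ^^ n) F) x"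
    by eventually_elim (rule Suc.IH, simp add: in_eball_iff)
  then have "deriv ((deriv ^^ n) (eval_fps F)) z = deriv (eval_fps ((fps_deriv ^^ n) F)) z"
    by (rule deriv_cong_ev) simp
  also have "\<dots> = eval_fps (fps_deriv ((fps_deriv ^^ n) F)) z"
    using Suc.prems fps_conv_radius_deriv_funpow[of F n] by (intro eval_fps_deriv [symmetric]) order
  finally show ?case by simp
qed simp

lemma sums_taylor_coefficient_eval_fps:
  fixes F :: "complex fps"
  assumes "ereal (norm a) < fps_conv_radius F"
  shows "(\<lambda>k. fps_nth F k * of_nat (k choose n) * a ^ (k - n)) sums
    ((deriv ^^ n) (eval_fps F) a / fact n)"
proof -
  have "(\<lambda>k. fps_nth ((fps_deriv ^^ n) F) k * a ^ k) sums eval_fps ((fps_deriv ^^ n) F) a"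
    using assms fps_conv_radius_deriv_funpow[of F n] by (intro sums_eval_fps) order
  then have "(\<lambda>k. fps_nth ((fps_deriv ^^ n) F) k * a ^ k / fact n) sums
      ((deriv ^^ n) (eval_fps F) a / fact n)"
    unfolding higher_deriv_eval_fps[OF assms] by (rule sums_divide)
  also have "(\<lambda>k. fps_nth ((fps_deriv ^^ n) F) k * a ^ k / fact n) =
      (\<lambda>k. fps_nth F (k + n) * of_nat (k + n choose n) * a ^ (k + n - n))"
    by (simp add: fun_eq_iff fps_deriv_funpow_nth binomial_fact ac_simps)
  finally show ?thesis by (rule sums_shift_zero) (simp add: binomial_eq_0)
qed

lemma has_fps_expansion_eval_fps_shift:
  fixes F :: "complex fps"
  assumes "ereal (norm a) < fps_conv_radius F"
  shows "(\<lambda>w. eval_fps F (a + w)) has_fps_expansion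
    Abs_fps (\<lambda>n. suminf (\<lambda>k. fps_nth F k * of_nat (k choose n) * a ^ (k - n)))"
proof -
  have "eval_fps F analytic_on {a}"
    using assms by (intro analytic_on_eval_fps) (auto simp: in_eball_iff)
  from analytic_at_imp_has_fps_expansion[OF this] show ?thesis
    by (simp add: fps_expansion_def sums_unique[OF sums_taylor_coefficient_eval_fps[OF assms]])
qed

lemma Suc_times_binomial_shift: "(k + n + 1) * (k + n choose n) = (n + 1) * (n + 1 + k choose k)"
  using Suc_times_binomial_eq[of "k + n" n] binomial_symmetric[of k "n + 1 + k"]
  by (simp add: ac_simps)

lemma sums_one_minus_power:
  fixes x :: complex
  assumes "norm x < 1"
  shows "(\<lambda>j. of_nat (n + j choose j) * x ^ j) sums (1 / (1 - x) ^ (n + 1))"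
proof -
  have 1: "1 - x \<noteq> 0" using assms by auto
  have 2: "(-1) ^ j * ((of_nat (n + 1) + of_nat j - 1) gchoose j) * (- x) ^ j =
      of_nat (n + j choose j) * x ^ j" for j
  proof -
    have "of_nat (n + 1) + of_nat j - 1 = (of_nat (n + j) :: complex)" by simp
    moreover have "(-1) ^ j * (-1) ^ j = (1 :: complex)" by (simp flip: power_mult_distrib)
    moreover have "(-1) ^ j * c * (- x) ^ j = ((-1) ^ j * (-1) ^ j) * (c * x ^ j)" for c
      by (subst power_minus) (simp only: ac_simps)
    ultimately show ?thesis by (simp only: binomial_gbinomial mult_1_left)
  qed
  have "(\<lambda>j. (-1) ^ j * ((of_nat (n + 1) + of_nat j - 1) gchoose j) * (- x) ^ j) sums
      (1 + - x) powr (- of_nat (n + 1))"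
    using assms by (intro one_plus_neg_powr_powser) simp
  also have "(1 + - x) powr (- of_nat (n + 1)) = 1 / (1 - x) ^ (n + 1)"
    unfolding powr_minus using 1 by (subst powr_nat') (simp_all add: inverse_eq_divide)
  finally show ?thesis unfolding 2 .
qed

lemma sums_e_taylor_series:
  fixes a v :: complex
  assumes "norm (a * v) < 1"
  shows "(\<lambda>k. of_nat ((k + 1) * (k choose n)) * a ^ (k - n) * v ^ k) sums
    (of_nat (n + 1) * v ^ n / (1 - a * v) ^ (n + 2))"
proof -
  have "(\<lambda>k. of_nat (n + 1) * v ^ n * (of_nat (n + 1 + k choose k) * (a * v) ^ k)) sums
      (of_nat (n + 1) * v ^ n * (1 / (1 - a * v) ^ (n + 1 + 1)))"
    by (intro sums_mult sums_one_minus_power assms)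
  also have "(\<lambda>k. of_nat (n + 1) * v ^ n * (of_nat (n + 1 + k choose k) * (a * v) ^ k)) =
      (\<lambda>k. of_nat (((k + n) + 1) * (k + n choose n)) * a ^ (k + n - n) * v ^ (k + n))"
    unfolding Suc_times_binomial_shift
    by (simp only: of_nat_mult power_mult_distrib power_add add_diff_cancel_right' ac_simps)
  also have "of_nat (n + 1) * v ^ n * (1 / (1 - a * v) ^ (n + 1 + 1)) =
      of_nat (n + 1) * v ^ n / (1 - a * v) ^ (n + 2)" by simp
  finally show ?thesis by (rule sums_shift_zero) (simp add: binomial_eq_0)
qed

text \<open>The coefficient with respect to \<open>dv\<close>, \<open>v = 1/u\<close>; note that \<open>DK_at\<close> refers to \<open>du = - v\<^sup>-\<^sup>2 dv\<close>
  at finite points.\<close>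

definition DK_inf :: "DK \<Rightarrow> complex \<Rightarrow> complex" where
  "DK_inf \<alpha> v = (if v = 0 then DK_at \<alpha> Infty else - DK_at \<alpha> (Pt (1 / v)) / v\<^sup>2)"

lemma Pt_inverse_notin_D: "cmod v \<le> 1 \<Longrightarrow> v \<noteq> 0 \<Longrightarrow> Pt (1 / v) \<notin> D"
proof -
  assume "cmod v \<le> 1" "v \<noteq> 0"
  then have "1 \<le> cmod (1 / v)" by (simp add: norm_divide)
  then show ?thesis by (auto simp: D_def)
qed

lemma Infty_notin_D: "Infty \<notin> D"
  by (simp add: D_def)

lemma DK_inf_add: "cmod v \<le> 1 \<Longrightarrow> DK_inf (\<alpha> + \<beta>) v = DK_inf \<alpha> v + DK_inf \<beta> v"
  by (simp add: DK_inf_def DK_at_add Pt_inverse_notin_D Infty_notin_D diff_divide_distrib)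

lemma DK_inf_cscale: "cmod v \<le> 1 \<Longrightarrow> DK_inf (c *c \<alpha>) v = c * DK_inf \<alpha> v"
  by (simp add: DK_inf_def DK_at_cscale Pt_inverse_notin_D Infty_notin_D)

lemma DK_inf_e_taylor:
  assumes "cmod a < 1" "cmod v \<le> 1"
  shows "DK_inf (e_taylor n a) v = of_nat (n + 1) * v ^ n / (1 - a * v) ^ (n + 2)"
proof -
  define f where "f = (\<lambda>u. - of_nat (n + 1) / (u - a) ^ (n + 2))"
  have at: "DK_at (e_taylor n a) p = remove_sings (in_chart f p) (chart_pt p)" for p
    unfolding e_taylor_abs[OF assms(1)] f_def
    using is_DK_polar[OF assms(1), of "- of_nat (n + 1)" n] by (subst DK_at.abs_eq) simp_all
  show ?thesis
  proof (cases "v = 0")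
    case True
    define g where "g = (\<lambda>v. of_nat (n + 1) * v ^ n / (1 - a * v) ^ (n + 2))"
    have g: "g analytic_on {0}" unfolding g_def by (auto intro!: analytic_intros)
    have "\<forall>\<^sub>F v in at 0. in_chart f Infty v = g v"
      using eventually_neq_at_within[of 0 0 UNIV]
    proof eventually_elim
      case (elim v)
      then have "1 / v - a = (1 - a * v) / v" by (simp add: field_simps)
      then have "in_chart f Infty v = of_nat (n + 1) / (((1 - a * v) / v) ^ (n + 2)) / v\<^sup>2"
        by (simp add: f_def minus_divide_left [symmetric] del: of_nat_Suc)
      also have "\<dots> = g v"
        using elim by (simp add: g_def power_divide power_add power2_eq_square)
      finally show ?case .
    qed
    then have "DK_at (e_taylor n a) Infty = remove_sings g 0"
      unfolding at by (intro remove_sings_cong) simp_all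
    with g True show ?thesis by (simp add: DK_inf_def g_def)
  next
    case False
    have "1 / v \<noteq> a"
      using Pt_inverse_notin_D[OF assms(2) False] assms(1) by (auto simp: D_def)
    then have "f analytic_on {1 / v}" unfolding f_def by (auto intro!: analytic_intros)
    then have "DK_at (e_taylor n a) (Pt (1 / v)) = f (1 / v)" by (simp add: at)
    also have "1 / v - a = (1 - a * v) / v" using False by (simp add: field_simps)
    then have "f (1 / v) = - of_nat (n + 1) / ((1 - a * v) ^ (n + 2) / (v ^ n * v\<^sup>2))"
      unfolding f_def by (simp only: power_divide power_add[of v])
    finally show ?thesis
      using False by (simp add: DK_inf_def minus_divide_left [symmetric] del: of_nat_Suc)
  qed
qed

definition DK_fps :: "DK \<Rightarrow> complex fps" where
  "DK_fps \<alpha> = (SOME F. fps_conv_radius F > 1 \<and> (\<forall>v. cmod v \<le> 1 \<longrightarrow> eval_fps F v = DK_inf \<alpha> v))"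

definition e_taylor_fps :: "nat \<Rightarrow> complex \<Rightarrow> complex fps" where
  "e_taylor_fps n a = Abs_fps (\<lambda>k. of_nat ((k + 1) * (k choose n)) * a ^ (k - n))"

lemma e_taylor_fps:
  assumes "cmod a < 1"
  shows "fps_conv_radius (e_taylor_fps n a) > 1"
    and "cmod v \<le> 1 \<Longrightarrow> eval_fps (e_taylor_fps n a) v = DK_inf (e_taylor n a) v"
proof -
  obtain r where r: "r > 1" "cmod a * r < 1"
  proof (cases "a = 0")
    case True
    then show ?thesis using that[of 2] by simp
  next
    case False
    then obtain r where "1 < r" "r < 1 / cmod a" using dense[of 1 "1 / cmod a"] assms by auto
    then show ?thesis using that[of r] False by (simp add: field_simps)
  qed
  have "summable (\<lambda>k. fps_nth (e_taylor_fps n a) k * of_real r ^ k)"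
    using sums_summable[OF sums_e_taylor_series[of a "of_real r" n]] r
    by (simp add: e_taylor_fps_def norm_mult)
  then have "ereal (norm (of_real r :: complex)) \<le> fps_conv_radius (e_taylor_fps n a)"
    unfolding fps_conv_radius_def by (rule conv_radius_geI)
  moreover have "ereal 1 < ereal (norm (of_real r :: complex))" using r by simp
  ultimately show "fps_conv_radius (e_taylor_fps n a) > 1"
    by (metis one_ereal_def order.strict_trans2)
  assume v: "cmod v \<le> 1"
  have "cmod (a * v) \<le> cmod a" using mult_left_le[OF v] by (simp add: norm_mult)
  then have "cmod (a * v) < 1" using assms by simp
  from sums_unique[OF sums_e_taylor_series[OF this, of n]]
  show "eval_fps (e_taylor_fps n a) v = DK_inf (e_taylor n a) v"
    unfolding DK_inf_e_taylor[OF assms v] by (simp only: eval_fps_def e_taylor_fps_def fps_nth_Abs_fps)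
qed

lemma eval_fps_const_mult: "ereal (norm z) < fps_conv_radius F \<Longrightarrow>
    eval_fps (fps_const c * F) z = c * eval_fps F z"
  for F :: "complex fps"
  by (subst eval_fps_mult) auto

lemma fps_conv_radius_const_mult_gt: "r < fps_conv_radius F \<Longrightarrow> r < fps_conv_radius (fps_const c * F)"
  for F :: "complex fps"
  by (cases "c = 0") (auto simp: fps_conv_radius_cmult_left elim: order.strict_trans2)

lemma DK_fps:
  shows "fps_conv_radius (DK_fps \<alpha>) > 1"
    and "cmod v \<le> 1 \<Longrightarrow> eval_fps (DK_fps \<alpha>) v = DK_inf \<alpha> v"
proof -
  have lt: "ereal (cmod v) < R" if "cmod v \<le> 1" "R > 1" for v R
    using that by (metis ereal_less_eq(3) one_ereal_def order.strict_trans1)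
  have "\<exists>F. fps_conv_radius F > 1 \<and> (\<forall>v. cmod v \<le> 1 \<longrightarrow> eval_fps F v = DK_inf \<alpha> v)"
  proof (induction \<alpha> rule: DK_induct)
    case (e_taylor n a)
    then show ?case using e_taylor_fps by blast
  next
    case (scale c \<alpha>)
    then obtain F where "fps_conv_radius F > 1" "\<And>v. cmod v \<le> 1 \<Longrightarrow> eval_fps F v = DK_inf \<alpha> v"
      by blast
    then show ?case
      by (intro exI[of _ "fps_const c * F"])
        (simp add: fps_conv_radius_const_mult_gt eval_fps_const_mult DK_inf_cscale lt)
  next
    case (add \<alpha> \<beta>)
    then obtain F G where "fps_conv_radius F > 1" "\<And>v. cmod v \<le> 1 \<Longrightarrow> eval_fps F v = DK_inf \<alpha> v"
      "fps_conv_radius G > 1" "\<And>v. cmod v \<le> 1 \<Longrightarrow> eval_fps G v = DK_inf \<beta> v" by blast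
    then show ?case
      by (intro exI[of _ "F + G"])
        (auto simp: eval_fps_add DK_inf_add lt intro!: order.strict_trans2[OF _ fps_conv_radius_add])
  qed
  from someI_ex[OF this]
  show "fps_conv_radius (DK_fps \<alpha>) > 1"
    and "cmod v \<le> 1 \<Longrightarrow> eval_fps (DK_fps \<alpha>) v = DK_inf \<alpha> v"
    unfolding DK_fps_def by blast+
qed

lemma norm_less_DK_fps_radius: "cmod v \<le> 1 \<Longrightarrow> ereal (cmod v) < fps_conv_radius (DK_fps \<alpha>)"
  using DK_fps(1)[of \<alpha>] by (metis ereal_less_eq(3) one_ereal_def order.strict_trans1)

lemma DK_fps_eqI:
  assumes "fps_conv_radius F > 1" "\<And>v. cmod v < 1 \<Longrightarrow> eval_fps F v = DK_inf \<alpha> v"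
  shows "DK_fps \<alpha> = F"
proof (rule eval_fps_eqD)
  have "(0::ereal) < 1" by simp
  then show "0 < fps_conv_radius (DK_fps \<alpha>)" "0 < fps_conv_radius F"
    using DK_fps(1)[of \<alpha>] assms(1) by order+
  have "\<forall>\<^sub>F z in nhds (0::complex). z \<in> ball 0 1" by (intro eventually_nhds_in_open) auto
  then show "\<forall>\<^sub>F z in nhds 0. eval_fps (DK_fps \<alpha>) z = eval_fps F z"
    by eventually_elim (simp add: DK_fps(2) assms(2))
qed

lemma DK_fps_e_taylor: "cmod a < 1 \<Longrightarrow> DK_fps (e_taylor n a) = e_taylor_fps n a"
  by (intro DK_fps_eqI) (simp_all add: e_taylor_fps)

lemma DK_fps_add: "DK_fps (\<alpha> + \<beta>) = DK_fps \<alpha> + DK_fps \<beta>"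
  by (intro DK_fps_eqI)
    (auto simp: eval_fps_add DK_inf_add DK_fps norm_less_DK_fps_radius
      intro!: order.strict_trans2[OF _ fps_conv_radius_add])

lemma DK_fps_cscale: "DK_fps (c *c \<alpha>) = fps_const c * DK_fps \<alpha>"
  by (intro DK_fps_eqI)
    (simp_all add: fps_conv_radius_const_mult_gt eval_fps_const_mult DK_inf_cscale DK_fps
      norm_less_DK_fps_radius)

text \<open>The weights are chosen such that \<open>e_form a\<close> represents evaluation at \<open>C(a)\<close>.\<close>

definition DK_form :: "DK \<Rightarrow> DK \<Rightarrow> complex" where
  "DK_form \<alpha> \<beta> = suminf (\<lambda>k. cnj (fps_nth (DK_fps \<alpha>) k) * fps_nth (DK_fps \<beta>) k / of_nat (k + 1))"

lemma summable_norm_DK_fps: "summable (\<lambda>k. norm (fps_nth (DK_fps \<alpha>) k))"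
  using norm_summable_fps[of 1 "DK_fps \<alpha>"] DK_fps(1)[of \<alpha>] by (simp add: one_ereal_def)

lemma DK_form_sums:
  "(\<lambda>k. cnj (fps_nth (DK_fps \<alpha>) k) * fps_nth (DK_fps \<beta>) k / of_nat (k + 1)) sums DK_form \<alpha> \<beta>"
proof -
  have "Bseq (\<lambda>k. norm (fps_nth (DK_fps \<beta>) k))"
    by (rule convergent_imp_Bseq[OF convergentI[OF summable_LIMSEQ_zero[OF summable_norm_DK_fps]]])
  then obtain M where "\<forall>k. norm (norm (fps_nth (DK_fps \<beta>) k)) \<le> M" by (rule BseqE)
  then have M: "norm (fps_nth (DK_fps \<beta>) k) \<le> M" for k by simp
  have "summable (\<lambda>k. cnj (fps_nth (DK_fps \<alpha>) k) * fps_nth (DK_fps \<beta>) k / of_nat (k + 1))"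
  proof (rule summable_comparison_test'[OF summable_mult2[OF summable_norm_DK_fps[of \<alpha>], of M]])
    fix k :: nat
    have "norm (cnj (fps_nth (DK_fps \<alpha>) k) * fps_nth (DK_fps \<beta>) k / of_nat (k + 1)) =
        norm (fps_nth (DK_fps \<alpha>) k) * norm (fps_nth (DK_fps \<beta>) k) / real (k + 1)"
      by (simp only: norm_divide norm_mult norm_of_nat complex_mod_cnj)
    also have "\<dots> \<le> norm (fps_nth (DK_fps \<alpha>) k) * norm (fps_nth (DK_fps \<beta>) k) / 1"
      by (intro divide_left_mono) auto
    also have "\<dots> = norm (fps_nth (DK_fps \<alpha>) k) * norm (fps_nth (DK_fps \<beta>) k)" by simp
    also have "\<dots> \<le> norm (fps_nth (DK_fps \<alpha>) k) * M" by (intro mult_left_mono M) auto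
    finally show "norm (cnj (fps_nth (DK_fps \<alpha>) k) * fps_nth (DK_fps \<beta>) k / of_nat (k + 1)) \<le>
      norm (fps_nth (DK_fps \<alpha>) k) * M" .
  qed
  then show ?thesis unfolding DK_form_def by (rule summable_sums)
qed

lemma hermitian_structure_DK_form: "hermitian_structure DK_form"
  unfolding hermitian_structure_def
proof (intro conjI allI)
  fix x y z :: DK and c :: complex
  show "DK_form x (y + z) = DK_form x y + DK_form x z"
    using sums_add[OF DK_form_sums[of x y] DK_form_sums[of x z]]
    by (intro sums_unique2[OF DK_form_sums]) (simp add: DK_fps_add distrib_left add_divide_distrib)
  show "DK_form (x + y) z = DK_form x z + DK_form y z"
    using sums_add[OF DK_form_sums[of x z] DK_form_sums[of y z]]
    by (intro sums_unique2[OF DK_form_sums]) (simp add: DK_fps_add distrib_right add_divide_distrib)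
  show "DK_form x (c *c y) = c * DK_form x y"
    using sums_mult[OF DK_form_sums[of x y], of c]
    by (intro sums_unique2[OF DK_form_sums]) (simp add: DK_fps_cscale ac_simps)
  show "DK_form (c *c x) y = cnj c * DK_form x y"
    using sums_mult[OF DK_form_sums[of x y], of "cnj c"]
    by (intro sums_unique2[OF DK_form_sums]) (simp add: DK_fps_cscale ac_simps)
  show "DK_form y x = cnj (DK_form x y)"
    using iffD2[OF sums_cnj DK_form_sums[of x y]]
    by (intro sums_unique2[OF DK_form_sums]) (simp add: mult.commute)
qed

lemma e_form_eq_e_taylor: "e_form a = e_taylor 0 a"
  by (cases "cmod a < 1") (simp_all add: e_form_def e_taylor_def power2_eq_square)

lemma DK_form_e_taylor:
  assumes "cmod a < 1"
  shows "DK_form \<beta> (e_taylor n a) =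
    suminf (\<lambda>k. cnj (fps_nth (DK_fps \<beta>) k) * of_nat (k choose n) * a ^ (k - n))"
proof -
  have "of_nat ((k + 1) * m) / of_nat (k + 1) = (of_nat m :: complex)" for k m
    unfolding of_nat_mult by (simp del: of_nat_Suc of_nat_add)
  then have "c * (of_nat ((k + 1) * m) * d) / of_nat (k + 1) = c * of_nat m * (d :: complex)" for c d k m
    by (metis (no_types, opaque_lifting) mult.assoc mult.commute times_divide_eq_right)
  then show ?thesis
    unfolding DK_form_def DK_fps_e_taylor[OF assms] e_taylor_fps_def fps_nth_Abs_fps by (simp only:)
qed

lemma DK_form_e_form_left:
  assumes "cmod a < 1"
  shows "DK_form (e_form a) \<beta> = DK_inf \<beta> (cnj a)"
proof -
  have "DK_form (e_form a) \<beta> = suminf (\<lambda>k. fps_nth (DK_fps \<beta>) k * cnj a ^ k)"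
    using assms unfolding DK_form_def e_form_eq_e_taylor DK_fps_e_taylor[OF assms]
    by (intro suminf_cong) (simp add: e_taylor_fps_def del: of_nat_Suc)
  also have "\<dots> = DK_inf \<beta> (cnj a)"
    using DK_fps(2)[of "cnj a" \<beta>] assms by (simp add: eval_fps_def)
  finally show ?thesis .
qed

lemma has_fps_expansion_DK_form_e_form:
  assumes "cmod a < 1"
  shows "(\<lambda>w. DK_form \<beta> (e_form (a + w))) has_fps_expansion Abs_fps (\<lambda>n. DK_form \<beta> (e_taylor n a))"
proof -
  define F where "F = Abs_fps (\<lambda>k. cnj (fps_nth (DK_fps \<beta>) k))"
  have radius: "fps_conv_radius F = fps_conv_radius (DK_fps \<beta>)"
    unfolding F_def fps_conv_radius_def conv_radius_def by simp
  have "ereal (cmod a) < fps_conv_radius F"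
    unfolding radius using assms by (intro norm_less_DK_fps_radius) simp
  from has_fps_expansion_eval_fps_shift[OF this]
  have "(\<lambda>w. eval_fps F (a + w)) has_fps_expansion Abs_fps (\<lambda>n. DK_form \<beta> (e_taylor n a))"
    by (simp add: DK_form_e_taylor[OF assms] F_def)
  moreover have ev: "\<forall>\<^sub>F w in nhds 0. eval_fps F (a + w) = DK_form \<beta> (e_form (a + w))"
  proof -
    have "open ((\<lambda>w. a + w) -` ball 0 1)" by (intro open_vimage continuous_intros) auto
    then have "\<forall>\<^sub>F w in nhds 0. w \<in> (\<lambda>w. a + w) -` ball 0 1"
      using assms by (intro eventually_nhds_in_open) auto
    then show ?thesis
      by eventually_elim (simp add: e_form_eq_e_taylor DK_form_e_taylor eval_fps_def F_def)
  qed
  ultimately show ?thesis using has_fps_expansion_cong[OF ev refl] by blast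
qed

section \<open>The adjointness relations\<close>

text \<open>\<open>- j_op v\<close> is the coefficient of \<open>i(z)\<close> with respect to \<open>dv\<close> at the point \<open>z\<close> where
  \<open>v = 1/u\<close> has the value \<open>v\<close>.  In this normalisation both adjointness relations, at all points
  including \<open>u = 0\<close> and \<open>Infty\<close>, take the form of \<open>adjoint_at\<close> below.\<close>

definition j_op :: "complex \<Rightarrow> DW \<Rightarrow> DW" where
  "j_op v = sym_deriv (\<lambda>\<alpha>. DK_inf \<alpha> v)"

lemma linear_functional_DK_inf: "cmod v \<le> 1 \<Longrightarrow> linear_functional (\<lambda>\<alpha>. DK_inf \<alpha> v)"
  by (simp add: linear_functional_def DK_inf_add DK_inf_cscale)

lemma
  assumes "cmod v \<le> 1"
  shows j_op_1: "j_op v 1 = 0"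
    and j_op_add: "j_op v (x + y) = j_op v x + j_op v y"
    and j_op_cscale: "j_op v (c *c x) = c *c j_op v x"
    and j_op_gen_mult: "j_op v (sym_gen \<alpha> * x) = DK_inf \<alpha> v *c x + sym_gen \<alpha> * j_op v x"
  using linear_functional_DK_inf[OF assms]
  by (simp_all add: j_op_def sym_deriv_props sym_deriv_add sym_deriv_cscale sym_deriv_gen_mult)

lemma i_op_Infty: "i_op Infty x = - 1 *c j_op 0 x"
proof -
  have "(\<lambda>\<alpha>. - DK_at \<alpha> Infty) = (\<lambda>\<alpha>. - 1 * DK_inf \<alpha> 0)" by (simp add: DK_inf_def)
  then show ?thesis
    unfolding i_op_def j_op_def by (simp only: sym_deriv_scaled linear_functional_DK_inf norm_zero zero_le_one)
qed

lemma i_op_Pt: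
  assumes "cmod v \<le> 1" "v \<noteq> 0"
  shows "i_op (Pt (1 / v)) x = v\<^sup>2 *c j_op v x"
proof -
  have "(\<lambda>\<alpha>. - DK_at \<alpha> (Pt (1 / v))) = (\<lambda>\<alpha>. v\<^sup>2 * DK_inf \<alpha> v)"
    using assms(2) by (simp add: DK_inf_def)
  then show ?thesis
    unfolding i_op_def j_op_def by (simp only: sym_deriv_scaled linear_functional_DK_inf assms(1))
qed

lemma holomorphic_DK_inf: "DK_inf \<alpha> holomorphic_on ball 0 1"
proof -
  have "eval_fps (DK_fps \<alpha>) holomorphic_on ball 0 1"
    using norm_less_DK_fps_radius[of _ \<alpha>] by (intro holomorphic_on_eval_fps) (auto simp: in_eball_iff)
  then show ?thesis
    by (rule holomorphic_transform) (simp add: DK_fps(2))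
qed

lemma holomorphic_j_op:
  assumes "linear_functional L"
  shows "(\<lambda>v. L (j_op v \<psi>)) holomorphic_on ball 0 1"
  using assms
proof (induction \<psi> arbitrary: L rule: sym_gen_induct)
  case one
  have "(\<lambda>_. L 0) holomorphic_on ball 0 1" by simp
  then show ?case
    by (rule holomorphic_transform) (simp add: j_op_1)
next
  case (scale c x)
  have "L (c *c y) = c * L y" for y using scale.prems by (simp add: linear_functional_def)
  moreover have "(\<lambda>v. c * L (j_op v x)) holomorphic_on ball 0 1"
    by (intro holomorphic_intros scale)
  ultimately show ?case
    by (elim holomorphic_transform) (simp add: j_op_cscale)
next
  case (add x y)
  have "L (x + y) = L x + L y" for x y using add.prems by (simp add: linear_functional_def)
  moreover have "(\<lambda>v. L (j_op v x) + L (j_op v y)) holomorphic_on ball 0 1"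
    by (intro holomorphic_intros add)
  ultimately show ?case
    by (elim holomorphic_transform) (simp add: j_op_add)
next
  case (gen \<alpha> x)
  have "L (c *c y + z) = c * L y + L z" for c y z
    using gen.prems by (simp add: linear_functional_def)
  moreover have "linear_functional (\<lambda>y. L (sym_gen \<alpha> * y))"
    using gen.prems by (simp add: linear_functional_def distrib_left cscale_mult_right)
  then have "(\<lambda>v. DK_inf \<alpha> v * L x + L (sym_gen \<alpha> * j_op v x)) holomorphic_on ball 0 1"
    by (intro holomorphic_intros holomorphic_DK_inf gen.IH)
  ultimately show ?case
    by (elim holomorphic_transform) (simp add: j_op_gen_mult)
qed

lemma ball_D_iff: "(\<forall>z\<in>D. P z) \<longleftrightarrow> (\<forall>a. cmod a < 1 \<longrightarrow> P (Pt a))"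
  by (auto simp: D_def)

lemma Pt_inverse_in_D': "cmod v < 1 \<Longrightarrow> v \<noteq> 0 \<Longrightarrow> Pt (1 / v) \<in> D'"
  by (auto simp: D'_altdef norm_divide)

lemma ball_D'_iff:
  "(\<forall>z\<in>D' - {Infty}. P z) \<longleftrightarrow> (\<forall>v. cmod v < 1 \<longrightarrow> v \<noteq> 0 \<longrightarrow> P (Pt (1 / v)))"
proof
  assume P: "\<forall>v. cmod v < 1 \<longrightarrow> v \<noteq> 0 \<longrightarrow> P (Pt (1 / v))"
  show "\<forall>z\<in>D' - {Infty}. P z"
  proof
    fix z assume "z \<in> D' - {Infty}"
    then obtain w where w: "z = Pt w" "cmod w > 1" by (auto simp: D'_altdef)
    then have "w \<noteq> 0" by auto
    with w P[rule_format, of "1 / w"] show "P z" by (simp add: norm_divide)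
  qed
qed (use Pt_inverse_in_D' in blast)

lemma eventually_in_chart_eq_on:
  assumes "A = D \<or> A = D'" "p \<in> A" "\<And>z. z \<in> A \<Longrightarrow> s z = t z"
  shows "\<forall>\<^sub>F v in at (chart_pt p). in_chart (\<lambda>w. s (Pt w)) p v = in_chart (\<lambda>w. t (Pt w)) p v"
proof (cases p)
  case (Pt a)
  define U where "U = {w. Pt w \<in> A}"
  have "U = ball 0 1 \<or> U = - cball 0 1"
    using assms(1) by (auto simp: U_def D_def D'_altdef)
  then have "open U" by (auto simp: open_Compl)
  then have "\<forall>\<^sub>F w in at a. w \<in> U"
    using assms(2) Pt by (intro eventually_at_in_open') (auto simp: U_def)
  then show ?thesis unfolding Pt by (auto simp: U_def assms(3) elim: eventually_mono)
next
  case Infty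
  with assms(1,2) have A: "A = D'" by (auto simp: D_def)
  have "\<forall>\<^sub>F v in at (0::complex). v \<in> ball 0 1 - {0}"
    by (intro eventually_at_in_open) auto
  then show ?thesis unfolding Infty
    by (auto simp: A Pt_inverse_in_D' assms(3) elim!: eventually_mono)
qed

lemma meromorphic_section_on_cong:
  assumes "A = D \<or> A = D'" "\<And>z. z \<in> A \<Longrightarrow> s z = t z"
  shows "meromorphic_section_on A s \<longleftrightarrow> meromorphic_section_on A t"
  unfolding meromorphic_section_on_def
  by (intro ball_cong refl meromorphic_on_cong) (use eventually_in_chart_eq_on assms in auto)

lemma eq_meromorphic_sections_on_iff:
  assumes "A = D \<or> A = D'" "meromorphic_section_on A s"
  shows "eq_meromorphic_sections_on A s t \<longleftrightarrow> (\<forall>z\<in>A. s z = t z)"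
  using assms meromorphic_section_on_cong[OF assms(1), of s t]
  by (auto simp: eq_meromorphic_sections_on_def)

lemma meromorphic_section_on_i_op:
  assumes "linear_functional L"
  shows "meromorphic_section_on D' (\<lambda>z. L (i_op z \<psi>))"
  unfolding meromorphic_section_on_def
proof
  fix p assume p: "p \<in> D'"
  define J where "J = (\<lambda>v. L (j_op v \<psi>))"
  have J: "J analytic_on {v}" if "cmod v < 1" for v
    unfolding analytic_at J_def
    using holomorphic_j_op[OF assms, of \<psi>] that by (intro exI[of _ "ball 0 1"]) simp
  define S where "S z = (case z of Infty \<Rightarrow> - J 0 | Pt w \<Rightarrow> J (1 / w) / w\<^sup>2)" for z
  have L_cscale: "L (c *c x) = c * L x" for c x using assms by (simp add: linear_functional_def)
  have S: "L (i_op z \<psi>) = S z" if "z \<in> D'" for z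
  proof (cases z)
    case (Pt w)
    with that have w: "cmod w > 1" by (auto simp: D'_altdef)
    then have "w \<noteq> 0" by auto
    with w i_op_Pt[of "1 / w" \<psi>] show ?thesis
      by (simp add: Pt S_def J_def L_cscale norm_divide power_divide)
  qed (simp add: S_def J_def i_op_Infty L_cscale)
  have "in_chart (\<lambda>w. S (Pt w)) p meromorphic_on {chart_pt p}"
  proof (cases p)
    case (Pt w)
    with p have w: "cmod w > 1" by (auto simp: D'_altdef)
    then have w0: "w \<noteq> 0" by auto
    have "J analytic_on {1 / w}" using w by (intro J) (simp add: norm_divide divide_less_eq)
    then have "(J \<circ> (\<lambda>w. 1 / w)) analytic_on {w}"
      using w0 by (intro analytic_on_compose) (auto intro!: analytic_intros)
    then have "(\<lambda>w. J (1 / w) / w\<^sup>2) analytic_on {w}"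
      using w0 by (intro analytic_intros) (auto simp: o_def)
    then show ?thesis by (simp add: Pt S_def analytic_on_imp_meromorphic_on)
  next
    case Infty
    have "(\<lambda>v. - J v) meromorphic_on {0}"
      by (intro analytic_on_imp_meromorphic_on analytic_intros J) simp
    also have "?this \<longleftrightarrow> (\<lambda>v. - S (Pt (1 / v)) / v\<^sup>2) meromorphic_on {0}"
      by (intro meromorphic_on_cong refl)
        (auto simp: eventually_at_filter S_def power_divide)
    finally show ?thesis by (simp add: Infty)
  qed
  moreover have "\<forall>\<^sub>F v in at (chart_pt p). in_chart (\<lambda>w. L (i_op (Pt w) \<psi>)) p v = in_chart (\<lambda>w. S (Pt w)) p v"
    using p S by (intro eventually_in_chart_eq_on) auto
  ultimately show "in_chart (\<lambda>w. L (i_op (Pt w) \<psi>)) p meromorphic_on {chart_pt p}"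
    by (subst meromorphic_on_cong[OF _ refl]) auto
qed

definition adjoint_at :: "(DW \<Rightarrow> DW \<Rightarrow> complex) \<Rightarrow> DW \<Rightarrow> DW \<Rightarrow> complex \<Rightarrow> bool" where
  "adjoint_at h \<xi> \<psi> a \<longleftrightarrow> h \<xi> (e_hat (Pt a) \<psi>) = h (j_op (cnj a) \<xi>) \<psi>"

context
  fixes h :: "DW \<Rightarrow> DW \<Rightarrow> complex"
  assumes h: "hermitian_structure h"
begin

private lemmas linear_h = hermitian_linear_functional[OF h]

lemma adjoint_at_cnj: "adjoint_at h \<psi> \<xi> (cnj v) \<longleftrightarrow> h \<xi> (j_op v \<psi>) = h (e_hat (Pt (cnj v)) \<xi>) \<psi>"
  unfolding adjoint_at_def hermitian_swap[OF h, of "e_hat (Pt (cnj v)) \<xi>" \<psi>]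
    hermitian_swap[OF h, of "j_op v \<psi>" \<xi>]
  by (auto simp: hermitian_swap[OF h, of "j_op v \<psi>" \<xi>])

lemma C_pull_i_op:
  assumes "cmod a < 1"
  shows "- C_pull (Pt a) (h (i_op (Cinv (Pt a)) \<xi>) \<psi>) = h (j_op (cnj a) \<xi>) \<psi>"
proof (cases "a = 0")
  case True
  then show ?thesis by (simp add: C_pull_def i_op_Infty hermitian_cscale_left[OF h])
next
  case False
  with assms show ?thesis
    by (simp add: C_pull_def i_op_Pt hermitian_cscale_left[OF h])
qed

lemma C_pull_e_hat_iff:
  assumes "cmod v < 1" "v \<noteq> 0"
  shows "h \<xi> (i_op (Pt (1 / v)) \<psi>) = - C_pull (Pt (1 / v)) (h (e_hat (Cinv (Pt (1 / v))) \<xi>) \<psi>)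
    \<longleftrightarrow> adjoint_at h \<psi> \<xi> (cnj v)"
  unfolding adjoint_at_cnj using assms
  by (simp add: C_pull_def i_op_Pt hermitian_cscale_right[OF h] power_divide)

lemma C_pull_e_hat_Infty_iff:
  "h \<xi> (i_op Infty \<psi>) = - C_pull Infty (h (e_hat (Cinv Infty) \<xi>) \<psi>) \<longleftrightarrow> adjoint_at h \<psi> \<xi> 0"
  using adjoint_at_cnj[of \<psi> \<xi> 0]
  by (simp add: C_pull_def i_op_Infty hermitian_cscale_right[OF h])

context
  assumes termwise: "pairs_termwise h"
begin

lemma analytic_e_hat:
  assumes "cmod a < 1"
  shows "(\<lambda>w. h \<xi> (e_hat (Pt w) \<psi>)) analytic_on {a}"
  using termwise assms unfolding pairs_termwise_def by (blast intro: has_fps_expansion_imp_analytic)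

lemma eq_sections_D_iff:
  "eq_meromorphic_sections_on D
     (\<lambda>z. h \<xi> (e_hat z \<psi>)) (\<lambda>z. - C_pull z (h (i_op (Cinv z) \<xi>) \<psi>)) \<longleftrightarrow>
   (\<forall>a. cmod a < 1 \<longrightarrow> adjoint_at h \<xi> \<psi> a)"
proof -
  have "meromorphic_section_on D (\<lambda>z. h \<xi> (e_hat z \<psi>))"
    unfolding meromorphic_section_on_def ball_D_iff
    by (simp add: analytic_e_hat analytic_on_imp_meromorphic_on)
  then show ?thesis
    by (subst eq_meromorphic_sections_on_iff) (auto simp only: ball_D_iff C_pull_i_op adjoint_at_def)
qed

lemma eq_sections_D'_iff:
  "eq_meromorphic_sections_on D'
     (\<lambda>z. h \<xi> (i_op z \<psi>)) (\<lambda>z. - C_pull z (h (e_hat (Cinv z) \<xi>) \<psi>)) \<longleftrightarrow>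
   (\<forall>a. cmod a < 1 \<longrightarrow> adjoint_at h \<psi> \<xi> a)"
  (is "eq_meromorphic_sections_on D' ?s ?t \<longleftrightarrow> _")
proof -
  have "eq_meromorphic_sections_on D' ?s ?t \<longleftrightarrow> (\<forall>z\<in>D'. ?s z = ?t z)"
    using meromorphic_section_on_i_op[OF linear_h] by (intro eq_meromorphic_sections_on_iff) auto
  also have "\<dots> \<longleftrightarrow> ?s Infty = ?t Infty \<and> (\<forall>z\<in>D' - {Infty}. ?s z = ?t z)"
    by (auto simp: D'_altdef)
  also have "\<dots> \<longleftrightarrow> adjoint_at h \<psi> \<xi> 0 \<and> (\<forall>v. cmod v < 1 \<longrightarrow> v \<noteq> 0 \<longrightarrow> adjoint_at h \<psi> \<xi> (cnj v))"
    unfolding ball_D'_iff C_pull_e_hat_Infty_iff using C_pull_e_hat_iff by blast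
  also have "\<dots> \<longleftrightarrow> (\<forall>a. cmod a < 1 \<longrightarrow> adjoint_at h \<psi> \<xi> a)"
    by (metis complex_cnj_cnj complex_cnj_zero complex_mod_cnj norm_zero zero_less_one)
  finally show ?thesis .
qed

lemma adjoint_at_removable:
  assumes "\<And>a. cmod a < 1 \<Longrightarrow> a \<noteq> 0 \<Longrightarrow> adjoint_at h \<xi> \<psi> a" "cmod a < 1"
  shows "adjoint_at h \<xi> \<psi> a"
proof (cases "a = 0")
  case True
  define J where "J = (\<lambda>v. h \<psi> (j_op v \<xi>))"
  have "isCont J 0"
    using holomorphic_j_op[OF linear_h, of \<psi> \<xi>] unfolding J_def
    by (auto dest!: holomorphic_on_imp_continuous_on simp: continuous_on_eq_continuous_at)
  moreover have "cnj \<midarrow>0\<rightarrow> 0"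
    using tendsto_cnj[OF tendsto_ident_at[of 0 UNIV]] by simp
  ultimately have "(\<lambda>a. cnj (J (cnj a))) \<midarrow>0\<rightarrow> cnj (J 0)"
    by (intro tendsto_cnj isCont_tendsto_compose[of 0 J])
  moreover have "\<forall>\<^sub>F a in at 0. h \<xi> (e_hat (Pt a) \<psi>) = cnj (J (cnj a))"
  proof -
    have "\<forall>\<^sub>F a in at (0::complex). a \<in> ball 0 1 - {0}" by (intro eventually_at_in_open) auto
    then show ?thesis
    proof eventually_elim
      case (elim a)
      then have "adjoint_at h \<xi> \<psi> a" by (intro assms(1)) auto
      then show ?case unfolding adjoint_at_def J_def by (simp only: hermitian_swap[OF h, of "j_op _ \<xi>" \<psi>])
    qed
  qed
  ultimately have "(\<lambda>a. h \<xi> (e_hat (Pt a) \<psi>)) \<midarrow>0\<rightarrow> cnj (J 0)"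
    by (simp only: tendsto_cong)
  moreover have "(\<lambda>a. h \<xi> (e_hat (Pt a) \<psi>)) \<midarrow>0\<rightarrow> h \<xi> (e_hat (Pt 0) \<psi>)"
    by (intro isContD analytic_at_imp_isCont analytic_e_hat) simp
  ultimately have "h \<xi> (e_hat (Pt 0) \<psi>) = cnj (J 0)" by (rule LIM_unique[symmetric])
  then show ?thesis
    by (simp only: True adjoint_at_def J_def complex_cnj_zero hermitian_swap[OF h, of "j_op _ \<xi>" \<psi>])
qed (use assms in blast)

lemma hat_D_iff:
  "(\<forall>z\<in>D. (ucoord z)\<^sup>2 * h \<xi> (e_hat z \<psi>) = h (i_hat (Cinv z) \<xi>) \<psi>) \<longleftrightarrow>
   (\<forall>a. cmod a < 1 \<longrightarrow> adjoint_at h \<xi> \<psi> a)"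
proof -
  have "(ucoord (Pt a))\<^sup>2 * h \<xi> (e_hat (Pt a) \<psi>) = h (i_hat (Cinv (Pt a)) \<xi>) \<psi> \<longleftrightarrow>
      (a \<noteq> 0 \<longrightarrow> adjoint_at h \<xi> \<psi> a)" if "cmod a < 1" for a
  proof (cases "a = 0")
    case True
    have "h (0 *c \<xi>) \<psi> = 0" by (simp only: hermitian_cscale_left[OF h]) simp
    with True show ?thesis by (simp add: i_hat_def cscale_0_left)
  next
    case False
    with that show ?thesis
      by (simp add: i_hat_def i_op_Pt hermitian_cscale_left[OF h] adjoint_at_def)
  qed
  then show ?thesis unfolding ball_D_iff using adjoint_at_removable by blast
qed

lemma hat_D'_iff:
  "(\<forall>z\<in>D' - {Infty}. (ucoord z)\<^sup>2 * h \<xi> (i_hat z \<psi>) = h (e_hat (Cinv z) \<xi>) \<psi>) \<longleftrightarrow>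
   (\<forall>a. cmod a < 1 \<longrightarrow> adjoint_at h \<psi> \<xi> a)"
proof -
  have "(ucoord (Pt (1 / v)))\<^sup>2 * h \<xi> (i_hat (Pt (1 / v)) \<psi>) = h (e_hat (Cinv (Pt (1 / v))) \<xi>) \<psi> \<longleftrightarrow>
      adjoint_at h \<psi> \<xi> (cnj v)" if "cmod v < 1" "v \<noteq> 0" for v
    unfolding adjoint_at_cnj using that
    by (simp add: i_hat_def i_op_Pt hermitian_cscale_right[OF h] power_divide)
  then have "(\<forall>z\<in>D' - {Infty}. (ucoord z)\<^sup>2 * h \<xi> (i_hat z \<psi>) = h (e_hat (Cinv z) \<xi>) \<psi>) \<longleftrightarrow>
      (\<forall>v. cmod v < 1 \<longrightarrow> v \<noteq> 0 \<longrightarrow> adjoint_at h \<psi> \<xi> (cnj v))"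
    unfolding ball_D'_iff by blast
  also have "\<dots> \<longleftrightarrow> (\<forall>a. cmod a < 1 \<longrightarrow> a \<noteq> 0 \<longrightarrow> adjoint_at h \<psi> \<xi> a)"
    by (metis complex_cnj_cnj complex_cnj_zero_iff complex_mod_cnj)
  also have "\<dots> \<longleftrightarrow> (\<forall>a. cmod a < 1 \<longrightarrow> adjoint_at h \<psi> \<xi> a)"
    using adjoint_at_removable by blast
  finally show ?thesis .
qed

end

end

section \<open>Existence and uniqueness\<close>

definition DW_form :: "DW \<Rightarrow> DW \<Rightarrow> complex" where
  "DW_form = sym_pair DK_form"

lemma hermitian_structure_DW_form: "hermitian_structure DW_form"
  unfolding DW_form_def by (rule hermitian_structure_sym_pair[OF hermitian_structure_DK_form])

lemma DW_form_gen:
  "DW_form (sym_gen \<alpha> * \<xi>) \<psi> = DW_form \<xi> (sym_deriv (DK_form \<alpha>) \<psi>)"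
  "DW_form \<xi> (sym_gen \<alpha> * \<psi>) = DW_form (sym_deriv (DK_form \<alpha>) \<xi>) \<psi>"
  unfolding DW_form_def by (rule sym_pair_gen[OF hermitian_structure_DK_form])+

lemma adjoint_at_DW_form:
  assumes "cmod a < 1"
  shows "adjoint_at DW_form \<xi> \<psi> a"
proof -
  have "DK_form (e_form a) = (\<lambda>\<beta>. DK_inf \<beta> (cnj a))"
    using assms by (intro ext DK_form_e_form_left)
  then show ?thesis by (simp add: adjoint_at_def e_hat_def j_op_def DW_form_gen)
qed

lemma pairs_termwise_DW_form: "pairs_termwise DW_form"
  unfolding pairs_termwise_def
proof (intro allI impI)
  fix \<xi> \<psi> :: DW and a :: complex
  assume a: "cmod a < 1"
  note herm = hermitian_structure_DW_form
  note lin = hermitian_linear_functional[OF hermitian_structure_DK_form]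
  have zero: "DW_form 0 \<psi> = 0" for \<psi>
    using hermitian_add_left[OF herm, of 0 0 \<psi>] by simp
  have "(\<lambda>w. DW_form \<xi> (sym_gen (e_form (a + w)) * \<psi>)) has_fps_expansion
      Abs_fps (\<lambda>n. DW_form \<xi> (sym_gen (e_taylor n a) * \<psi>))"
  proof (induction \<xi> arbitrary: \<psi> rule: sym_gen_induct)
    case one
    have "DW_form 1 (sym_gen \<alpha> * \<psi>) = 0" for \<alpha>
      by (simp add: DW_form_gen sym_deriv_props lin zero)
    then show ?case by (simp flip: fps_zero_def)
  next
    case (scale c x)
    have "Abs_fps (\<lambda>n. cnj c * F n) = fps_const (cnj c) * Abs_fps F" for F
      by (simp add: fps_eq_iff)
    with has_fps_expansion_cmult_left[OF scale, of "cnj c"] show ?case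
      by (simp add: hermitian_cscale_left[OF herm])
  next
    case (add x y)
    have "Abs_fps (\<lambda>n. F n + G n) = Abs_fps F + Abs_fps G" for F G :: "nat \<Rightarrow> complex"
      by (simp add: fps_eq_iff)
    with has_fps_expansion_add[OF add] show ?case
      by (simp add: hermitian_add_left[OF herm])
  next
    case (gen \<beta> x)
    have "DW_form (sym_gen \<beta> * x) (sym_gen \<alpha> * \<psi>) =
        DK_form \<beta> \<alpha> * DW_form x \<psi> + DW_form x (sym_gen \<alpha> * sym_deriv (DK_form \<beta>) \<psi>)" for \<alpha>
      by (simp only: DW_form_gen(1) sym_deriv_gen_mult[OF lin] hermitian_add_right[OF herm]
          hermitian_cscale_right[OF herm])
    moreover have "Abs_fps (\<lambda>n. F n * c + G n) = Abs_fps F * fps_const c + Abs_fps G"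
      for F G :: "nat \<Rightarrow> complex" and c
      by (simp add: fps_eq_iff)
    ultimately show ?case
      using has_fps_expansion_add[OF has_fps_expansion_cmult_right[OF
          has_fps_expansion_DK_form_e_form[OF a]] gen]
      by simp
  qed
  then show "(\<lambda>w. DW_form \<xi> (e_hat (Pt (a + w)) \<psi>)) has_fps_expansion
      Abs_fps (\<lambda>n. DW_form \<xi> (sym_gen (e_taylor n a) * \<psi>))"
    by (simp add: e_hat_def)
qed

text \<open>Adjointness only controls the pairing with multiples of the forms \<open>e_form a\<close>.  Termwise
  pairing extends this to the \<open>e_taylor n a\<close>, which span.\<close>

lemma pairing_gen_mult_eqI:
  assumes h: "hermitian_structure h" "pairs_termwise h"
      "\<And>\<xi> \<psi> a. cmod a < 1 \<Longrightarrow> adjoint_at h \<xi> \<psi> a"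
    and h': "hermitian_structure h'" "pairs_termwise h'"
      "\<And>\<xi> \<psi> a. cmod a < 1 \<Longrightarrow> adjoint_at h' \<xi> \<psi> a"
    and eq: "\<And>v. cmod v < 1 \<Longrightarrow> h (j_op v \<xi>) \<psi> = h' (j_op v \<xi>) \<psi>"
  shows "h \<xi> (sym_gen \<alpha> * \<psi>) = h' \<xi> (sym_gen \<alpha> * \<psi>)"
proof (induction \<alpha> rule: DK_induct)
  case (e_taylor n a)
  let ?F = "\<lambda>h. Abs_fps (\<lambda>n. h \<xi> (sym_gen (e_taylor n a) * \<psi>) :: complex)"
  have "(\<lambda>w. h \<xi> (e_hat (Pt (a + w)) \<psi>)) has_fps_expansion ?F h"
    using h(2) e_taylor unfolding pairs_termwise_def by blast
  moreover have "(\<lambda>w. h' \<xi> (e_hat (Pt (a + w)) \<psi>)) has_fps_expansion ?F h'"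
    using h'(2) e_taylor unfolding pairs_termwise_def by blast
  moreover have ev: "\<forall>\<^sub>F w in nhds 0. h \<xi> (e_hat (Pt (a + w)) \<psi>) = h' \<xi> (e_hat (Pt (a + w)) \<psi>)"
  proof -
    have "open ((\<lambda>w. a + w) -` ball 0 1)" by (intro open_vimage continuous_intros) auto
    then have "\<forall>\<^sub>F w in nhds 0. w \<in> (\<lambda>w. a + w) -` ball 0 1"
      using e_taylor by (intro eventually_nhds_in_open) auto
    then show ?thesis
    proof eventually_elim
      case (elim w)
      then have "cmod (a + w) < 1" by simp
      with h(3)[of "a + w" \<xi> \<psi>] h'(3)[of "a + w" \<xi> \<psi>] eq[of "cnj (a + w)"] show ?case
        by (simp only: adjoint_at_def complex_mod_cnj)
    qed
  qed
  ultimately have "?F h = ?F h'"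
    using has_fps_expansion_cong[OF ev refl] fps_expansion_unique_complex by blast
  then show ?case by (simp add: fps_eq_iff)
next
  case (scale c \<alpha>)
  then show ?case
    by (simp add: sym_gen_cscale cscale_mult_left hermitian_cscale_right[OF h(1)]
        hermitian_cscale_right[OF h'(1)])
next
  case (add \<alpha> \<beta>)
  then show ?case
    by (simp add: sym_gen_add distrib_right hermitian_add_right[OF h(1)]
        hermitian_add_right[OF h'(1)])
qed

lemma pairing_unique:
  assumes h: "hermitian_structure h" "pairs_termwise h"
      "\<And>\<xi> \<psi> a. cmod a < 1 \<Longrightarrow> adjoint_at h \<xi> \<psi> a"
    and h': "hermitian_structure h'" "pairs_termwise h'"
      "\<And>\<xi> \<psi> a. cmod a < 1 \<Longrightarrow> adjoint_at h' \<xi> \<psi> a"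
    and one: "h 1 1 = h' 1 1"
  shows "h = h'"
proof -
  note simps = hermitian_cscale_right[OF h(1)] hermitian_cscale_right[OF h'(1)]
    hermitian_add_right[OF h(1)] hermitian_add_right[OF h'(1)]
  have zero: "h 0 \<psi> = 0" "h' 0 \<psi> = 0" for \<psi>
    using hermitian_add_left[OF h(1), of 0 0 \<psi>] hermitian_add_left[OF h'(1), of 0 0 \<psi>] by simp_all
  have vac: "h 1 \<psi> = h' 1 \<psi>" for \<psi>
  proof (induction \<psi> rule: sym_gen_induct)
    case (gen \<alpha> x)
    show ?case by (rule pairing_gen_mult_eqI[OF h h']) (simp_all only: j_op_1 less_imp_le zero)
  qed (simp_all add: one simps)
  have "h \<xi> \<psi> = h' \<xi> \<psi>" for \<xi> \<psi>
  proof (induction \<psi> arbitrary: \<xi> rule: sym_gen_induct)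
    case one
    show ?case
      using vac[of \<xi>]
      by (simp only: hermitian_swap[OF h(1), of \<xi> 1] hermitian_swap[OF h'(1), of \<xi> 1])
  next
    case (gen \<alpha> x)
    then show ?case by (intro pairing_gen_mult_eqI[OF h h'])
  qed (simp_all add: simps)
  then show ?thesis by (intro ext)
qed

theorem proposition7p6:
  "(\<exists>!h :: DW \<Rightarrow> DW \<Rightarrow> complex.
      hermitian_structure h \<and> pairs_termwise h \<and> h 1 1 = 1 \<and>
      (\<forall>\<xi> \<psi>.
         eq_meromorphic_sections_on D
           (\<lambda>z. h \<xi> (e_hat z \<psi>)) (\<lambda>z. - C_pull z (h (i_op (Cinv z) \<xi>) \<psi>)) \<and>
         eq_meromorphic_sections_on D'
           (\<lambda>z. h \<xi> (i_op z \<psi>)) (\<lambda>z. - C_pull z (h (e_hat (Cinv z) \<xi>) \<psi>)))) \<and>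
   (\<forall>(h :: DW \<Rightarrow> DW \<Rightarrow> complex) \<xi> \<psi>. hermitian_structure h \<and> pairs_termwise h \<longrightarrow>
      (eq_meromorphic_sections_on D
         (\<lambda>z. h \<xi> (e_hat z \<psi>)) (\<lambda>z. - C_pull z (h (i_op (Cinv z) \<xi>) \<psi>)) \<longleftrightarrow>
       (\<forall>z\<in>D. (ucoord z)\<^sup>2 * h \<xi> (e_hat z \<psi>) = h (i_hat (Cinv z) \<xi>) \<psi>)) \<and>
      (eq_meromorphic_sections_on D'
         (\<lambda>z. h \<xi> (i_op z \<psi>)) (\<lambda>z. - C_pull z (h (e_hat (Cinv z) \<xi>) \<psi>)) \<longleftrightarrow>
       (\<forall>z\<in>D' - {Infty}. (ucoord z)\<^sup>2 * h \<xi> (i_hat z \<psi>) = h (e_hat (Cinv z) \<xi>) \<psi>)))"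
  (is "(\<exists>!h. ?P h) \<and> (\<forall>h \<xi> \<psi>. _ \<longrightarrow> ?R h \<xi> \<psi>)" is "_ \<and> ?Q")
proof
  have P_iff: "?P h \<longleftrightarrow> hermitian_structure h \<and> pairs_termwise h \<and> h 1 1 = 1 \<and>
      (\<forall>\<xi> \<psi> a. cmod a < 1 \<longrightarrow> adjoint_at h \<xi> \<psi> a)" for h
    by (cases "hermitian_structure h \<and> pairs_termwise h")
      (auto simp only: eq_sections_D_iff eq_sections_D'_iff)
  show "\<exists>!h. ?P h"
    unfolding P_iff
  proof (rule ex1I)
    have "DW_form 1 1 = 1"
      unfolding DW_form_def by (rule sym_pair_1_1[OF hermitian_structure_DK_form])
    then show "hermitian_structure DW_form \<and> pairs_termwise DW_form \<and> DW_form 1 1 = 1 \<and>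
        (\<forall>\<xi> \<psi> a. cmod a < 1 \<longrightarrow> adjoint_at DW_form \<xi> \<psi> a)"
      using hermitian_structure_DW_form pairs_termwise_DW_form adjoint_at_DW_form by blast
    then show "h = DW_form" if "hermitian_structure h \<and> pairs_termwise h \<and> h 1 1 = 1 \<and>
        (\<forall>\<xi> \<psi> a. cmod a < 1 \<longrightarrow> adjoint_at h \<xi> \<psi> a)" for h
      using that by (intro pairing_unique) auto
  qed
  show ?Q
  proof (intro allI impI)
    fix h :: "DW \<Rightarrow> DW \<Rightarrow> complex" and \<xi> \<psi>
    assume "hermitian_structure h \<and> pairs_termwise h"
    then have h: "hermitian_structure h" "pairs_termwise h" by blast+
    show "?R h \<xi> \<psi>"
      unfolding eq_sections_D_iff[OF h] eq_sections_D'_iff[OF h] hat_D_iff[OF h] hat_D'_iff[OF h]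
      by simp
  qed
qed

end
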